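(* Let $s$ be an odd prime, let $p,q$ be positive integers with $p\le q$, and let $n=p+q$. Then the following $(p+q)\times n$ matrix $\mathcal{G}$ over $\mathrm{GF}(s)$, whose first $p$ rows form $\mathcal{G}_c$ and whose last $q$ rows form $\mathcal{G}_r$, yields a 2fi-optimal $s^n$ full factorial row-column design (arranged in an $s^p\times s^q$ array). (a) For $1=p\le q$: $$\mathcal{G}=\left(\begin{array}{cc} 1 & \boldsymbol{1}_q^T\\ \hline \boldsymbol{1}_q & I_q+J_q\end{array}\right).$$ (b) For $2=p\le q$: $$\mathcal{G}=\left(\begin{array}{ccc} I_2 & M & X_*\\ \hline I_2 & M+I_2 & \boldsymbol{0}_{2\times(q-2)}\\ \boldsymbol{0}_{(q-2)\times 2} & \boldsymbol{0}_{(q-2)\times 2} & I_{q-2}\end{array}\right),\qquad M=\begin{pmatrix}1&1\\2&1\end{pmatrix},$$ where $X_*$ is a $2\times(q-2)$ matrix, with no zero column, selected so that each point of $\mathrm{PG}(1,s)$ appears among the columns of the $2\times n$ matrix $(I_2\;\; M\;\; X_* )$ either $\alpha$ or $\alpha+1$ times, where $\alpha=\lfloor n/(s+1)\rfloor$. (c) For $3\le p\le q$: $$\mathcal{G}=\left(\begin{array}{ccc} I_p & J_p+H_p & Y_*\\ \hline H_p & J_p+2I_p & \boldsymbol{0}_{p\times(q-p)}\\ \boldsymbol{0}_{(q-p)\times p} & \boldsymbol{0}_{(q-p)\times p} & I_{q-p}\end{array}\right),$$ where $Y_*$ is a $p\times(q-p)$ matrix, with no zero column, selected so that each point of $\mathrm{PG}(p-1,s)$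 appears among the columns of the $p\times n$ matrix $(I_p\;\; J_p+H_p\;\; Y_* )$ either $\alpha$ or $\alpha+1$ times, where $\alpha=\lfloor n(s-1)/(s^p-1)\rfloor$.
   Context: Matrices. $s$ is a prime and all matrices have entries in $\mathrm{GF}(s)=\mathbb{Z}/s$ (integers are reduced mod $s$). $I_v$ is the $v\times v$ identity, $J_v$ the $v\times v$ all-ones matrix, $\boldsymbol{1}_v$ the $v\times1$ all-ones vector, $\boldsymbol{0}_{v\times w}$ the zero matrix, and $H_v=(h_{ij})$ the $v\times v$ matrix with $h_{ij}=1$ if $i+j=v+1$ and $h_{ij}=0$ otherwise. Blocks with zero rows or columns are omitted. $\mathrm{PG}(m-1,s)$ is the set of 1-dimensional subspaces ("points") of $\mathrm{GF}(s)^m$; a nonzero column vector belongs to (is an appearance of) the point it spans. Designs. Let $p,q\ge1$, $p+q\le n$. An array generator matrix is a $(p+q)\times n$ matrix $\mathcal{G}$ over $\mathrm{GF}(s)$ of full row rank $p+q$; $\mathcal{G}_c$ denotes its first $p$ rows, $\mathcal{G}_r$ its last $q$ rows, and $\mathcal{G}_i,\mathcal{G}_{c,i},\mathcal{G}_{r,i}$ the $i$-th columns of $\mathcal{G},\mathcal{G}_c,\mathcal{G}_r$. If $\boldsymbol{x}_1,\dots,\boldsymbol{x}_{s^p}$ are the vectors of the row space of $\mathcal{G}_c$ and $\boldsymbol{y}_1,\dots,\boldsymbol{y}_{s^q}$ those of the row space of $\mathcal{G}_r$ (with $\boldsymbol{x}_1=\boldsymbol{y}_1=0$), $\mathcal{G}$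 yields the $s^p\times s^q$ row-column design whose cell $(i,j)$ carries the level combination $d[i,j]=\boldsymbol{x}_i+\boldsymbol{y}_j\in\mathrm{GF}(s)^n$ of the $n$ factors $F_1,\dots,F_n$. It is an $s^n$ full factorial design when $p+q=n$, and an $s^{n-k}$ fractional factorial design when $p+q=n-k<n$. Model and confounding. $Y_{ij}=\mu+\tau_i+\rho_j+\gamma_{d[i,j]}+\varepsilon_{ij}$, with row effects $\tau_i$, column effects $\rho_j$, uncorrelated mean-zero errors of variance $\sigma^2$, and $\gamma_{(x_1,\dots,x_n)}=\sum_l\alpha_{l,x_l}+\sum_{l<m}\sum_{v=1}^{s-1}\beta^{(v)}_{lm,\,x_l+vx_m}$, where $\sum_u\alpha_{l,u}=0$ and $\sum_u\beta^{(v)}_{lm,u}=0$. A main effect $F_l$ is unconfounded if the estimators of the $\alpha_{l,u}$ are uncorrelated with all other estimators in the model; the two-factor interaction (2fi) $F_l\times F_m$ is unconfounded if for every $v=1,\dots,s-1$ the estimators of the $\beta^{(v)}_{lm,u}$ are uncorrelated with all other estimators in the model. Interactions of three or more factors are assumed negligible. Equivalent algebraic criterion (known result, Zhou and Zhou 2023), usable as the definition of confounding. A main effect or 2fi is confounded with another main effect or 2fi iff the columns of $\mathcal{G}$ corresponding to the (distinct) factors involved in the two effects are linearly dependent. If $\mathcal{G}_i\ne0$, $F_i$ is confounded with column effects iff $\mathcal{G}_{c,i}=0$, and with row effects iff $\mathcal{G}_{r,i}=0$. If $\mathcal{G}_i,\mathcal{G}_j$ are linearly independent, $F_i\times F_j$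 is confounded with column effects iff $\mathcal{G}_{c,i},\mathcal{G}_{c,j}$ are linearly dependent, and with row effects iff $\mathcal{G}_{r,i},\mathcal{G}_{r,j}$ are linearly dependent. An effect is unconfounded iff none of these confoundings occurs. 2fi-optimality. The design yielded by $\mathcal{G}$ is 2fi-optimal if all main effects are unconfounded and the number of unconfounded 2fi's is maximum among all designs yielded by array generator matrices with the same $(s,p,q,n)$ for which all main effects are unconfounded. *)

theory Defs
  imports
    "Berlekamp_Zassenhaus.Finite_Field"
    "Jordan_Normal_Form.DL_Rank"
begin

text \<open>
  For a type of class \<open>prime_card\<close>, the type \<open>'s mod_ring\<close> is the ring of integers modulo
  the prime \<open>CARD('s)\<close>, so it plays the role of GF(s) with \<open>s = CARD('s)\<close>.
  Rows, columns and factors are numbered from 0.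
\<close>

section \<open>Matrices\<close>

definition ones_mat :: "nat \<Rightarrow> nat \<Rightarrow> 'a::one mat" where
  "ones_mat v w = mat v w (\<lambda>_. 1)"

text \<open>With 1-based indices the condition below reads \<open>i + j = v + 1\<close>.\<close>

definition antidiag_mat :: "nat \<Rightarrow> 'a::zero_neq_one mat" where
  "antidiag_mat v = mat v v (\<lambda>(i, j). if i + j + 1 = v then 1 else 0)"

text \<open>Side-by-side juxtaposition, the counterpart of \<open>append_rows\<close>.\<close>

definition append_cols :: "'a::zero mat \<Rightarrow> 'a mat \<Rightarrow> 'a mat" (infixr "@\<^sub>c" 70) where
  "A @\<^sub>c B = four_block_mat A B (0\<^sub>m 0 (dim_col A)) (0\<^sub>m 0 (dim_col B))"

text \<open>
  Linear dependence of the family of columns of \<open>A\<close> indexed by \<open>K\<close>. As this refers to a family,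
  two equal columns with different indices are dependent; a single column is
  dependent iff it is zero.
\<close>

definition cols_dependent :: "'a::field mat \<Rightarrow> nat set \<Rightarrow> bool" where
  "cols_dependent A K \<longleftrightarrow>
     (\<exists>c. (\<exists>k\<in>K. c k \<noteq> 0) \<and> (\<forall>i<dim_row A. (\<Sum>k\<in>K. c k * A $$ (i, k)) = 0))"

section \<open>Points of projective space\<close>

definition line_through :: "'a::field vec \<Rightarrow> 'a vec set" where
  "line_through v = {c \<cdot>\<^sub>v v |c. True}"

text \<open>PG(m - 1, s), the set of one-dimensional subspaces of the space of \<open>m\<close>-vectors.\<close>

definition proj_points :: "nat \<Rightarrow> 'a::field vec set set" where
  "proj_points m = {line_through v |v. v \<in> carrier_vec m \<and> v \<noteq> 0\<^sub>v m}"

definition appearances :: "'a::field mat \<Rightarrow> 'a vec set \<Rightarrow> nat" where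
  "appearances A P =
     card {j. j < dim_col A \<and> col A j \<noteq> 0\<^sub>v (dim_row A) \<and> line_through (col A j) = P}"

definition no_zero_col :: "'a::zero mat \<Rightarrow> bool" where
  "no_zero_col A \<longleftrightarrow> (\<forall>j<dim_col A. col A j \<noteq> 0\<^sub>v (dim_row A))"

section \<open>Array generator matrices and row-column designs\<close>

definition array_generator :: "nat \<Rightarrow> nat \<Rightarrow> nat \<Rightarrow> 'a::field mat \<Rightarrow> bool" where
  "array_generator p q n G \<longleftrightarrow>
     1 \<le> p \<and> 1 \<le> q \<and> p + q \<le> n \<and> G \<in> carrier_mat (p + q) n \<and>
     vec_space.rank (p + q) G = p + q"

definition top_rows :: "nat \<Rightarrow> 'a mat \<Rightarrow> 'a mat" where
  "top_rows p G = mat p (dim_col G) (\<lambda>(i, j). G $$ (i, j))"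

definition bottom_rows :: "nat \<Rightarrow> 'a mat \<Rightarrow> 'a mat" where
  "bottom_rows p G = mat (dim_row G - p) (dim_col G) (\<lambda>(i, j). G $$ (p + i, j))"

text \<open>
  \<open>d i j\<close> is the level combination in cell \<open>(i, j)\<close>. The row spaces may be listed in any
  order starting with the zero vector, so \<open>d\<close> is determined by \<open>G\<close> only up to
  permutations of the rows and of the columns.
\<close>

definition yields_design ::
  "nat \<Rightarrow> nat \<Rightarrow> nat \<Rightarrow> 's::prime_card mod_ring mat \<Rightarrow>
   (nat \<Rightarrow> nat \<Rightarrow> 's mod_ring vec) \<Rightarrow> bool" where
  "yields_design p q n G d \<longleftrightarrow>
     (\<exists>x y.
        bij_betw x {..<CARD('s) ^ p} (vec_space.row_space n (top_rows p G)) \<and>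
        bij_betw y {..<CARD('s) ^ q} (vec_space.row_space n (bottom_rows p G)) \<and>
        x 0 = 0\<^sub>v n \<and> y 0 = 0\<^sub>v n \<and>
        (\<forall>i<CARD('s) ^ p. \<forall>j<CARD('s) ^ q. d i j = x i + y j))"

text \<open>Every level combination of the \<open>n\<close> factors occurs in exactly one cell of the array.\<close>

definition full_factorial ::
  "nat \<Rightarrow> nat \<Rightarrow> nat \<Rightarrow> (nat \<Rightarrow> nat \<Rightarrow> 's::prime_card mod_ring vec) \<Rightarrow> bool" where
  "full_factorial p q n d \<longleftrightarrow>
     bij_betw (\<lambda>(i, j). d i j) ({..<CARD('s) ^ p} \<times> {..<CARD('s) ^ q}) (carrier_vec n)"

section \<open>Confounding and optimality\<close>

text \<open>
  An effect is represented by the set of factors it involves: \<open>{i}\<close> for a main effect,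
  \<open>{i, j}\<close> with \<open>i \<noteq> j\<close> for a two-factor interaction. Confounding is defined by the algebraic
  criterion of Zhou and Zhou (2023).
\<close>

definition main_effects :: "nat \<Rightarrow> nat set set" where
  "main_effects n = {A. A \<subseteq> {..<n} \<and> card A = 1}"

definition two_fis :: "nat \<Rightarrow> nat set set" where
  "two_fis n = {A. A \<subseteq> {..<n} \<and> card A = 2}"

definition confounded_with :: "'a::field mat \<Rightarrow> nat set \<Rightarrow> nat set \<Rightarrow> bool" where
  "confounded_with G A B \<longleftrightarrow> A \<noteq> B \<and> cols_dependent G (A \<union> B)"

text \<open>
  The criterion for confounding with column or row effects presupposes that the columns of \<open>G\<close>
  indexed by the effect are independent. No such guard is needed here: if they are dependent,
  the effect is already confounded with some other main effect (as \<open>n \<ge> 2\<close>), hence not unconfounded.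
\<close>

definition confounded_with_columns :: "nat \<Rightarrow> 'a::field mat \<Rightarrow> nat set \<Rightarrow> bool" where
  "confounded_with_columns p G A \<longleftrightarrow> cols_dependent (top_rows p G) A"

definition confounded_with_rows :: "nat \<Rightarrow> 'a::field mat \<Rightarrow> nat set \<Rightarrow> bool" where
  "confounded_with_rows p G A \<longleftrightarrow> cols_dependent (bottom_rows p G) A"

definition unconfounded :: "nat \<Rightarrow> nat \<Rightarrow> 'a::field mat \<Rightarrow> nat set \<Rightarrow> bool" where
  "unconfounded p n G A \<longleftrightarrow>
     (\<forall>B \<in> main_effects n \<union> two_fis n. \<not> confounded_with G A B) \<and>
     \<not> confounded_with_columns p G A \<and> \<not> confounded_with_rows p G A"

definition main_effects_unconfounded :: "nat \<Rightarrow> nat \<Rightarrow> 'a::field mat \<Rightarrow> bool" where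
  "main_effects_unconfounded p n G \<longleftrightarrow> (\<forall>A \<in> main_effects n. unconfounded p n G A)"

definition num_unconfounded_2fis :: "nat \<Rightarrow> nat \<Rightarrow> 'a::field mat \<Rightarrow> nat" where
  "num_unconfounded_2fis p n G = card {A \<in> two_fis n. unconfounded p n G A}"

definition two_fi_optimal :: "nat \<Rightarrow> nat \<Rightarrow> nat \<Rightarrow> 'a::field mat \<Rightarrow> bool" where
  "two_fi_optimal p q n G \<longleftrightarrow>
     array_generator p q n G \<and> main_effects_unconfounded p n G \<and>
     (\<forall>G' :: 'a mat. array_generator p q n G' \<and> main_effects_unconfounded p n G' \<longrightarrow>
        num_unconfounded_2fis p n G' \<le> num_unconfounded_2fis p n G)"

definition yields_2fi_optimal_full_factorial ::
  "nat \<Rightarrow> nat \<Rightarrow> nat \<Rightarrow> 's::prime_card mod_ring mat \<Rightarrow> bool" where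
  "yields_2fi_optimal_full_factorial p q n G \<longleftrightarrow>
     array_generator p q n G \<and>
     (\<exists>d. yields_design p q n G d) \<and>
     (\<forall>d. yields_design p q n G d \<longrightarrow> full_factorial p q n d) \<and>
     two_fi_optimal p q n G"

section \<open>The generator matrices\<close>

definition generator_a :: "nat \<Rightarrow> 'a::field mat" where
  "generator_a q =
     (1\<^sub>m 1 @\<^sub>c ones_mat 1 q) @\<^sub>r
     (ones_mat q 1 @\<^sub>c (1\<^sub>m q + ones_mat q q))"

definition M_mat :: "'a::field mat" where
  "M_mat = mat_of_rows_list 2 [[1, 1], [2, 1]]"

definition generator_b :: "nat \<Rightarrow> 'a::field mat \<Rightarrow> 'a mat" where
  "generator_b q X =
     (1\<^sub>m 2 @\<^sub>c M_mat @\<^sub>c X) @\<^sub>r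
     (1\<^sub>m 2 @\<^sub>c (M_mat + 1\<^sub>m 2) @\<^sub>c 0\<^sub>m 2 (q - 2)) @\<^sub>r
     (0\<^sub>m (q - 2) 2 @\<^sub>c 0\<^sub>m (q - 2) 2 @\<^sub>c 1\<^sub>m (q - 2))"

definition generator_c :: "nat \<Rightarrow> nat \<Rightarrow> 'a::field mat \<Rightarrow> 'a mat" where
  "generator_c p q Y =
     (1\<^sub>m p @\<^sub>c (ones_mat p p + antidiag_mat p) @\<^sub>c Y) @\<^sub>r
     (antidiag_mat p @\<^sub>c (ones_mat p p + 2 \<cdot>\<^sub>m 1\<^sub>m p) @\<^sub>c 0\<^sub>m p (q - p)) @\<^sub>r
     (0\<^sub>m (q - p) p @\<^sub>c 0\<^sub>m (q - p) p @\<^sub>c 1\<^sub>m (q - p))"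

definition admissible_X :: "nat \<Rightarrow> 's::prime_card mod_ring mat \<Rightarrow> bool" where
  "admissible_X q X \<longleftrightarrow>
     X \<in> carrier_mat 2 (q - 2) \<and> no_zero_col X \<and>
     (let \<alpha> = (2 + q) div (CARD('s) + 1) in
      \<forall>P \<in> proj_points 2. appearances (1\<^sub>m 2 @\<^sub>c M_mat @\<^sub>c X) P \<in> {\<alpha>, \<alpha> + 1})"

definition admissible_Y :: "nat \<Rightarrow> nat \<Rightarrow> 's::prime_card mod_ring mat \<Rightarrow> bool" where
  "admissible_Y p q Y \<longleftrightarrow>
     Y \<in> carrier_mat p (q - p) \<and> no_zero_col Y \<and>
     (let \<alpha> = (p + q) * (CARD('s) - 1) div (CARD('s) ^ p - 1) in
      \<forall>P \<in> proj_points p.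
        appearances (1\<^sub>m p @\<^sub>c (ones_mat p p + antidiag_mat p) @\<^sub>c Y) P \<in> {\<alpha>, \<alpha> + 1})"

end

theory Submission
  imports Defs "Berlekamp_Zassenhaus.Berlekamp_Type_Based"
begin

text \<open>
  For \<open>n = p + q\<close> the generator is a nonsingular square matrix. Its columns are independent, so no two
  effects are confounded with each other (\<open>unconfounded_nonsingular_iff\<close>): a main effect is unconfounded
  when the top and bottom parts of its column are nonzero, and an interaction is unconfounded when
  the top parts of its two columns are independent and so are the bottom parts.
  Nonsingularity also makes the design a full factorial (\<open>nonsingular_yields_full_factorial\<close>).

  Unconfounded main effects force the top parts to be nonzero, so the \<open>n\<close> factors are distributed over
  the points of \<open>PG(p - 1, s)\<close>, and two factors at the same point have a confounded interaction. If
  the point \<open>P\<close> receives \<open>n\<^sub>P\<close> factors, at least the sum of the binomials \<open>n\<^sub>P choose 2\<close> interactions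
  are lost. The total of the \<open>n\<^sub>P\<close> is \<open>n\<close>, and by convexity the sum is smallest when all \<open>n\<^sub>P\<close> lie in
  \<open>{\<alpha>, \<alpha> + 1}\<close> for some \<open>\<alpha>\<close> (\<open>balanced_minimizes_pairs\<close>). Hence a generator whose top parts are
  balanced in this sense and whose bottom parts are pairwise independent is optimal
  (\<open>two_fi_optimal_if_balanced\<close>).

  For \<open>p \<ge> 2\<close> the generators have block rows \<open>(I A Y)\<close>, \<open>(C D 0)\<close>, \<open>(0 0 I)\<close> with \<open>D = C A + I\<close>. This
  relation makes them nonsingular, and pairwise independence of the columns of \<open>(C D)\<close> carries over
  to the whole bottom part (\<open>block_generator_optimal\<close>). It remains to check by hand that the columns
  of \<open>(I A)\<close> and of \<open>(C D)\<close> are pairwise independent; odd \<open>s\<close> enters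
  here, through \<open>2 \<noteq> 0\<close>. As the
  columns of \<open>(I A)\<close> represent distinct points, a balanced \<open>Y\<close> exists
  (\<open>ex_balanced_completion\<close>). For \<open>p = 1\<close> there is only one point, every interaction is
  confounded in every design, and only the main effects matter; the diagonal entries 2 of \<open>I + J\<close>
  are nonzero because \<open>s\<close> is odd.
\<close>

section \<open>Juxtaposed and stacked blocks\<close>

lemma dim_append_cols [simp]:
  "dim_row (A @\<^sub>c B) = dim_row A" "dim_col (A @\<^sub>c B) = dim_col A + dim_col B"
  by (auto simp: append_cols_def)

lemma index_append_cols [simp]:
  assumes "i < dim_row A" "j < dim_col A + dim_col B" "dim_row B = dim_row A"
  shows "(A @\<^sub>c B) $$ (i, j) = (if j < dim_col A then A $$ (i, j) else B $$ (i, j - dim_col A))"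
  using assms by (auto simp: append_cols_def)

lemma append_cols_carrier [simp, intro]:
  "A \<in> carrier_mat m a \<Longrightarrow> B \<in> carrier_mat m b \<Longrightarrow> A @\<^sub>c B \<in> carrier_mat m (a + b)"
  by auto

lemma append_cols_assoc:
  assumes "A \<in> carrier_mat m a" "B \<in> carrier_mat m b" "C \<in> carrier_mat m c"
  shows "(A @\<^sub>c B) @\<^sub>c C = A @\<^sub>c B @\<^sub>c C"
  using assms by (intro eq_matI) auto

lemma col_append_cols:
  assumes "A \<in> carrier_mat m a" "B \<in> carrier_mat m b" "j < a + b"
  shows "col (A @\<^sub>c B) j = (if j < a then col A j else col B (j - a))"
  using assms by (intro eq_vecI) auto

lemma row_append_cols:
  assumes "A \<in> carrier_mat m a" "B \<in> carrier_mat m b" "i < m"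
  shows "row (A @\<^sub>c B) i = row A i @\<^sub>v row B i"
  using assms by (intro eq_vecI) auto

lemma mult_vec_append_cols:
  assumes "A \<in> carrier_mat m a" "B \<in> carrier_mat m b" "u \<in> carrier_vec a" "v \<in> carrier_vec b"
  shows "(A @\<^sub>c B) *\<^sub>v (u @\<^sub>v v) = A *\<^sub>v u + B *\<^sub>v v"
proof (rule eq_vecI)
  fix i assume "i < dim_vec (A *\<^sub>v u + B *\<^sub>v v)"
  then have i: "i < m" using assms by auto
  show "((A @\<^sub>c B) *\<^sub>v (u @\<^sub>v v)) $ i = (A *\<^sub>v u + B *\<^sub>v v) $ i"
    using assms i by (simp add: row_append_cols[OF assms(1,2) i] scalar_prod_append[of _ a _ b])
qed (use assms in auto)

lemma index_append_rows [simp]: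
  assumes "i < dim_row A + dim_row B" "j < dim_col A" "dim_col B = dim_col A"
  shows "(A @\<^sub>r B) $$ (i, j) = (if i < dim_row A then A $$ (i, j) else B $$ (i - dim_row A, j))"
  using assms by (auto simp: append_rows_def)

lemma dim_append_rows [simp]:
  "dim_row (A @\<^sub>r B) = dim_row A + dim_row B" "dim_col (A @\<^sub>r B) = dim_col A"
  by (auto simp: append_rows_def)

lemma top_rows_append_rows:
  assumes "A \<in> carrier_mat p n" "B \<in> carrier_mat q n"
  shows "top_rows p (A @\<^sub>r B) = A"
  using assms by (intro eq_matI) (auto simp: top_rows_def)

lemma bottom_rows_append_rows:
  assumes "A \<in> carrier_mat p n" "B \<in> carrier_mat q n"
  shows "bottom_rows p (A @\<^sub>r B) = B"
  using assms by (intro eq_matI) (auto simp: bottom_rows_def)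

lemma top_rows_carrier [simp, intro]:
  "G \<in> carrier_mat m n \<Longrightarrow> top_rows p G \<in> carrier_mat p n"
  by (auto simp: top_rows_def)

lemma bottom_rows_carrier [simp, intro]:
  "G \<in> carrier_mat (p + q) n \<Longrightarrow> bottom_rows p G \<in> carrier_mat q n"
  by (auto simp: bottom_rows_def)

lemma transpose_mult_append_vec:
  assumes G: "G \<in> carrier_mat (p + q) n" and u: "u \<in> carrier_vec p" and w: "w \<in> carrier_vec q"
  shows "G\<^sup>T *\<^sub>v (u @\<^sub>v w) = (top_rows p G)\<^sup>T *\<^sub>v u + (bottom_rows p G)\<^sup>T *\<^sub>v w"
proof (rule eq_vecI)
  fix j assume "j < dim_vec ((top_rows p G)\<^sup>T *\<^sub>v u + (bottom_rows p G)\<^sup>T *\<^sub>v w)"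
  then have j: "j < n" using G by (auto simp: bottom_rows_def)
  have "col G j = col (top_rows p G) j @\<^sub>v col (bottom_rows p G) j"
    using G j by (intro eq_vecI) (auto simp: top_rows_def bottom_rows_def)
  moreover have "col (top_rows p G) j \<in> carrier_vec p" "col (bottom_rows p G) j \<in> carrier_vec q"
    using G by (auto intro!: carrier_vecI simp: top_rows_def bottom_rows_def)
  ultimately show "(G\<^sup>T *\<^sub>v (u @\<^sub>v w)) $ j
      = ((top_rows p G)\<^sup>T *\<^sub>v u + (bottom_rows p G)\<^sup>T *\<^sub>v w) $ j"
    using G j u w by (simp add: scalar_prod_append[of _ p _ q] top_rows_def bottom_rows_def)
qed (use G in \<open>auto simp: bottom_rows_def\<close>)

section \<open>Nonsingular generators yield full factorial designs\<close>

lemma inj_on_mult_mat_vec: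
  fixes A :: "'a::field mat"
  assumes A: "A \<in> carrier_mat n n" and "det A \<noteq> 0"
  shows "inj_on ((*\<^sub>v) A) (carrier_vec n)"
proof (rule inj_onI)
  fix v w assume vw: "v \<in> carrier_vec n" "w \<in> carrier_vec n" "A *\<^sub>v v = A *\<^sub>v w"
  then have "A *\<^sub>v (v - w) = 0\<^sub>v n"
    using A by (simp add: mult_minus_distrib_mat_vec[OF A])
  then have "v - w = 0\<^sub>v n"
    using \<open>det A \<noteq> 0\<close> vw det_0_iff_vec_prod_zero_field[OF A] by (meson minus_carrier_vec)
  show "v = w"
  proof (rule eq_vecI)
    fix i assume "i < dim_vec w"
    then show "v $ i = w $ i"
      using arg_cong[OF \<open>v - w = 0\<^sub>v n\<close>, of "\<lambda>x. x $ i"] vw by auto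
  qed (use vw in auto)
qed

text \<open>
  The designs are built from enumerations of the two row spaces that begin with the zero
  vector; any enumeration becomes one of these after a transposition.
\<close>

lemma ex_enumeration_starting_with:
  assumes "finite S" "z \<in> S"
  shows "\<exists>x. bij_betw x {..<card S} S \<and> x 0 = z"
proof -
  obtain h where h: "bij_betw h {..<card S} S"
    using ex_bij_betw_nat_finite[OF assms(1)] by (auto simp: atLeast0LessThan)
  then obtain k where k: "k < card S" "h k = z"
    using assms(2) by (metis bij_betw_iff_bijections lessThan_iff)
  have "bij_betw (Transposition.transpose 0 k) {..<card S} {..<card S}"
    using k by (intro bij_betwI[of _ _ _ "Transposition.transpose 0 k"])
      (auto simp: Transposition.transpose_def)
  then have "bij_betw (h \<circ> Transposition.transpose 0 k) {..<card S} S"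
    using h by (rule bij_betw_trans)
  then show ?thesis using k by (intro exI[of _ "h \<circ> Transposition.transpose 0 k"]) auto
qed

lemma row_space_image:
  assumes "A \<in> carrier_mat m n"
  shows "vec_space.row_space n A = (\<lambda>u. A\<^sup>T *\<^sub>v u) ` carrier_vec m"
  using assms by (auto simp: vec_space.row_space_eq[OF assms])

text \<open>
  A vector of the top row space is \<open>T\<^sup>T u\<close> and one of the bottom row space is \<open>B\<^sup>T w\<close>, where \<open>T\<close> and \<open>B\<close>
  are the two parts of \<open>G\<close>. Their sum is \<open>G\<^sup>T\<close> applied to \<open>u\<close> stacked on \<open>w\<close>, and \<open>G\<^sup>T\<close> is
  injective. So distinct cells carry distinct level combinations, and there are as many cells as
  level combinations.
\<close>

theorem nonsingular_yields_full_factorial: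
  fixes G :: "'s::prime_card mod_ring mat"
  assumes G: "G \<in> carrier_mat (p + q) (p + q)" and det: "det G \<noteq> 0"
  shows "\<exists>d. yields_design p q (p + q) G d"
    and "yields_design p q (p + q) G d \<Longrightarrow> full_factorial p q (p + q) d"
proof -
  let ?T = "(top_rows p G)\<^sup>T" and ?B = "(bottom_rows p G)\<^sup>T"
  let ?R = "vec_space.row_space (p + q) (top_rows p G)"
  let ?S = "vec_space.row_space (p + q) (bottom_rows p G)"
  have inj: "inj_on ((*\<^sub>v) G\<^sup>T) (carrier_vec (p + q))"
    using G det by (intro inj_on_mult_mat_vec) (auto simp: det_transpose[OF G])
  have TB: "?T \<in> carrier_mat (p + q) p" "?B \<in> carrier_mat (p + q) q"
    using G by auto
  have R: "?R = (\<lambda>u. ?T *\<^sub>v u) ` carrier_vec p" and S: "?S = (\<lambda>u. ?B *\<^sub>v u) ` carrier_vec q"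
    using G by (auto simp: row_space_image[of _ p] row_space_image[of _ q])
  have sum_inj: "u = u' \<and> w = w'"
    if "u \<in> carrier_vec p" "u' \<in> carrier_vec p" "w \<in> carrier_vec q" "w' \<in> carrier_vec q"
      "?T *\<^sub>v u + ?B *\<^sub>v w = ?T *\<^sub>v u' + ?B *\<^sub>v w'" for u u' w w'
  proof -
    have "G\<^sup>T *\<^sub>v (u @\<^sub>v w) = G\<^sup>T *\<^sub>v (u' @\<^sub>v w')"
      using that by (simp only: transpose_mult_append_vec[OF G])
    then have "u @\<^sub>v w = u' @\<^sub>v w'"
      by (rule inj_onD[OF inj]) (use that in auto)
    then show ?thesis using append_vec_eq[OF that(1,2)] by simp
  qed
  have injT: "inj_on (\<lambda>u. ?T *\<^sub>v u) (carrier_vec p)" and injB: "inj_on (\<lambda>u. ?B *\<^sub>v u) (carrier_vec q)"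
    using sum_inj[of _ _ "0\<^sub>v q" "0\<^sub>v q"] sum_inj[of "0\<^sub>v p" "0\<^sub>v p"] by (auto intro!: inj_onI)
  have fin: "finite ?R" "finite ?S" unfolding R S by auto
  have card: "card ?R = CARD('s) ^ p" "card ?S = CARD('s) ^ q"
    unfolding R S by (simp_all add: card_image injT injB card_carrier_vec)
  have "?T *\<^sub>v 0\<^sub>v p = 0\<^sub>v (p + q)" "?B *\<^sub>v 0\<^sub>v q = 0\<^sub>v (p + q)"
    using TB by (auto intro!: eq_vecI)
  then have zero: "0\<^sub>v (p + q) \<in> ?R" "0\<^sub>v (p + q) \<in> ?S"
    unfolding R S by (metis image_eqI zero_carrier_vec)+
  show "\<exists>d. yields_design p q (p + q) G d"
  proof -
    obtain x y where "bij_betw x {..<CARD('s) ^ p} ?R" "x 0 = 0\<^sub>v (p + q)"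
      "bij_betw y {..<CARD('s) ^ q} ?S" "y 0 = 0\<^sub>v (p + q)"
      using ex_enumeration_starting_with[OF fin(1) zero(1)]
        ex_enumeration_starting_with[OF fin(2) zero(2)] card by auto
    then have "yields_design p q (p + q) G (\<lambda>i j. x i + y j)"
      unfolding yields_design_def by blast
    then show ?thesis by blast
  qed
  show "full_factorial p q (p + q) d" if "yields_design p q (p + q) G d"
  proof -
    from that obtain x y where x: "bij_betw x {..<CARD('s) ^ p} ?R"
      and y: "bij_betw y {..<CARD('s) ^ q} ?S"
      and d: "\<And>i j. i < CARD('s) ^ p \<Longrightarrow> j < CARD('s) ^ q \<Longrightarrow> d i j = x i + y j"
      unfolding yields_design_def by blast
    let ?C = "{..<CARD('s) ^ p} \<times> {..<CARD('s) ^ q}"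
    let ?f = "\<lambda>(i, j). d i j"
    have inR: "x i \<in> ?R" if "i < CARD('s) ^ p" for i using x that by (auto simp: bij_betw_def)
    have inS: "y j \<in> ?S" if "j < CARD('s) ^ q" for j using y that by (auto simp: bij_betw_def)
    have "inj_on ?f ?C"
    proof (rule inj_onI, clarsimp)
      fix i j i' j' assume *: "i < CARD('s) ^ p" "i' < CARD('s) ^ p" "j < CARD('s) ^ q"
        "j' < CARD('s) ^ q" "d i j = d i' j'"
      obtain u u' where u: "u \<in> carrier_vec p" "u' \<in> carrier_vec p" "x i = ?T *\<^sub>v u" "x i' = ?T *\<^sub>v u'"
        using inR[of i] inR[of i'] * unfolding R by auto
      obtain w w' where w: "w \<in> carrier_vec q" "w' \<in> carrier_vec q" "y j = ?B *\<^sub>v w" "y j' = ?B *\<^sub>v w'"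
        using inS[of j] inS[of j'] * unfolding S by auto
      have "x i = x i'" "y j = y j'" using sum_inj[of u u' w w'] u w * d by auto
      then show "i = i' \<and> j = j'"
        using x y * by (auto simp: bij_betw_def inj_on_def)
    qed
    moreover have "?f ` ?C \<subseteq> carrier_vec (p + q)"
    proof (clarsimp)
      fix i j assume *: "i < CARD('s) ^ p" "j < CARD('s) ^ q"
      then show "d i j \<in> carrier_vec (p + q)"
        using inR[of i] inS[of j] TB unfolding R S by (auto simp: d)
    qed
    ultimately have "?f ` ?C = carrier_vec (p + q)"
      by (intro card_subset_eq)
        (simp_all add: card_image card_carrier_vec card_cartesian_product power_add)
    with \<open>inj_on ?f ?C\<close> show ?thesis
      unfolding full_factorial_def bij_betw_def by blast
  qed
qed

section \<open>Dependence of one or two columns\<close>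

lemma cols_dependent_single:
  "cols_dependent A {i} \<longleftrightarrow> (\<forall>r<dim_row A. A $$ (r, i) = 0)"
proof
  assume "\<forall>r<dim_row A. A $$ (r, i) = 0"
  then show "cols_dependent A {i}"
    unfolding cols_dependent_def by (intro exI[of _ "\<lambda>_. 1"]) simp
qed (auto simp: cols_dependent_def)

lemma cols_dependent_pair:
  assumes "i \<noteq> j"
  shows "cols_dependent A {i, j} \<longleftrightarrow>
    (\<exists>a b. (a \<noteq> 0 \<or> b \<noteq> 0) \<and> (\<forall>r<dim_row A. a * A $$ (r, i) + b * A $$ (r, j) = 0))"
    (is "_ \<longleftrightarrow> ?R")
proof
  assume "cols_dependent A {i, j}"
  then obtain c where "c i \<noteq> 0 \<or> c j \<noteq> 0"
    "\<forall>r<dim_row A. c i * A $$ (r, i) + c j * A $$ (r, j) = 0"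
    using assms unfolding cols_dependent_def by auto
  then show ?R by blast
next
  assume ?R
  then obtain a b where "a \<noteq> 0 \<or> b \<noteq> 0" "\<forall>r<dim_row A. a * A $$ (r, i) + b * A $$ (r, j) = 0"
    by blast
  then show "cols_dependent A {i, j}"
    using assms unfolding cols_dependent_def by (intro exI[of _ "\<lambda>k. if k = i then a else b"]) auto
qed

lemma cols_dependent_single_iff_zero_col:
  assumes "j < dim_col A"
  shows "cols_dependent A {j} \<longleftrightarrow> col A j = 0\<^sub>v (dim_row A)"
proof -
  have "col A j = 0\<^sub>v (dim_row A) \<longleftrightarrow> (\<forall>r<dim_row A. A $$ (r, j) = 0)"
    using assms by (simp add: vec_eq_iff)
  then show ?thesis unfolding cols_dependent_single by blast
qed

lemma cols_dependent_mono_pair: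
  assumes "cols_dependent A {i}"
  shows "cols_dependent A {i, j}"
proof (cases "i = j")
  case False
  have "\<forall>r<dim_row A. 1 * A $$ (r, i) + 0 * A $$ (r, j) = 0"
    using assms by (simp add: cols_dependent_single)
  then show ?thesis
    unfolding cols_dependent_pair[OF False] using zero_neq_one by metis
qed (use assms in simp)

lemma line_through_eq_iff:
  fixes v w :: "'a::field vec"
  assumes "v \<in> carrier_vec m" "w \<in> carrier_vec m" "v \<noteq> 0\<^sub>v m" "w \<noteq> 0\<^sub>v m"
  shows "line_through v = line_through w \<longleftrightarrow> (\<exists>c. c \<noteq> 0 \<and> v = c \<cdot>\<^sub>v w)"
proof
  assume "line_through v = line_through w"
  moreover have "v \<in> line_through v" unfolding line_through_def by (auto intro: exI[of _ 1])
  ultimately obtain c where "v = c \<cdot>\<^sub>v w" unfolding line_through_def by auto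
  moreover have "c \<noteq> 0" using assms calculation by auto
  ultimately show "\<exists>c. c \<noteq> 0 \<and> v = c \<cdot>\<^sub>v w" by blast
next
  assume "\<exists>c. c \<noteq> 0 \<and> v = c \<cdot>\<^sub>v w"
  then obtain c where c: "c \<noteq> 0" "v = c \<cdot>\<^sub>v w" by blast
  have "a \<cdot>\<^sub>v w = (a / c) \<cdot>\<^sub>v v" for a using c by (simp add: smult_smult_assoc)
  moreover have "a \<cdot>\<^sub>v v = (a * c) \<cdot>\<^sub>v w" for a using c by (simp add: smult_smult_assoc)
  ultimately show "line_through v = line_through w" unfolding line_through_def by blast
qed

text \<open>
  This is where confounding becomes geometry: an interaction is confounded with column effects
  when its two factors sit at the same point of the projective space of top columns.
\<close>

lemma cols_dependent_pair_iff_same_point: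
  fixes A :: "'a::field mat"
  assumes ij: "i \<noteq> j" "i < dim_col A" "j < dim_col A"
    and nz: "col A i \<noteq> 0\<^sub>v (dim_row A)" "col A j \<noteq> 0\<^sub>v (dim_row A)"
  shows "cols_dependent A {i, j} \<longleftrightarrow> line_through (col A i) = line_through (col A j)"
proof -
  have nz': "\<exists>r<dim_row A. A $$ (r, i) \<noteq> 0" "\<exists>r<dim_row A. A $$ (r, j) \<noteq> 0"
    using nz ij by (auto simp: vec_eq_iff)
  have "cols_dependent A {i, j} \<longleftrightarrow> (\<exists>c. c \<noteq> 0 \<and> (\<forall>r<dim_row A. A $$ (r, i) = c * A $$ (r, j)))"
    (is "_ \<longleftrightarrow> ?R")
  proof
    assume "cols_dependent A {i, j}"
    then obtain a b where ab: "a \<noteq> 0 \<or> b \<noteq> 0"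
      "\<And>r. r < dim_row A \<Longrightarrow> a * A $$ (r, i) + b * A $$ (r, j) = 0"
      using ij by (auto simp: cols_dependent_pair)
    have "a \<noteq> 0" "b \<noteq> 0" using ab nz' by force+
    moreover have "A $$ (r, i) = (- b / a) * A $$ (r, j)" if "r < dim_row A" for r
      using ab(2)[OF that] \<open>a \<noteq> 0\<close> by (simp add: field_simps eq_neg_iff_add_eq_0)
    ultimately show ?R by (intro exI[of _ "- b / a"]) auto
  next
    assume ?R
    then obtain c where "\<forall>r<dim_row A. A $$ (r, i) = c * A $$ (r, j)" by blast
    then have "\<forall>r<dim_row A. 1 * A $$ (r, i) + (- c) * A $$ (r, j) = 0" by simp
    then show "cols_dependent A {i, j}"
      unfolding cols_dependent_pair[OF ij(1)] using zero_neq_one by metis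
  qed
  also have "\<dots> \<longleftrightarrow> (\<exists>c. c \<noteq> 0 \<and> col A i = c \<cdot>\<^sub>v col A j)"
    using ij by (auto simp: vec_eq_iff)
  also have "\<dots> \<longleftrightarrow> line_through (col A i) = line_through (col A j)"
    using line_through_eq_iff[OF _ _ nz] by simp
  finally show ?thesis .
qed

lemma no_zero_colI:
  assumes "\<And>j. j < dim_col A \<Longrightarrow> \<exists>i<dim_row A. A $$ (i, j) \<noteq> 0"
  shows "no_zero_col A"
  unfolding no_zero_col_def
proof (intro allI impI notI)
  fix j assume "j < dim_col A" "col A j = 0\<^sub>v (dim_row A)"
  moreover from this obtain i where "i < dim_row A" "A $$ (i, j) \<noteq> 0" using assms by blast
  ultimately show False by (auto dest!: arg_cong[where f="\<lambda>v. v $ i"])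
qed

lemma no_zero_col_append_cols:
  assumes A: "A \<in> carrier_mat m a" and B: "B \<in> carrier_mat m b"
    and "no_zero_col A" "no_zero_col B"
  shows "no_zero_col (A @\<^sub>c B)"
  using assms by (auto simp: no_zero_col_def col_append_cols[OF A B])

definition pairwise_independent_cols :: "'a::field mat \<Rightarrow> bool" where
  "pairwise_independent_cols A \<longleftrightarrow>
     (\<forall>i<dim_col A. \<forall>j<dim_col A. i \<noteq> j \<longrightarrow> \<not> cols_dependent A {i, j})"

lemma pairwise_independent_colsI:
  assumes "\<And>i j a b. i < j \<Longrightarrow> j < dim_col A \<Longrightarrow>
    (\<And>r. r < dim_row A \<Longrightarrow> a * A $$ (r, i) + b * A $$ (r, j) = 0) \<Longrightarrow> a = 0 \<and> b = 0"
  shows "pairwise_independent_cols A"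
  unfolding pairwise_independent_cols_def
proof (intro allI impI notI)
  fix i j assume ij: "i < dim_col A" "j < dim_col A" "i \<noteq> j" "cols_dependent A {i, j}"
  then obtain a b where ab: "a \<noteq> 0 \<or> b \<noteq> 0"
    "\<And>r. r < dim_row A \<Longrightarrow> a * A $$ (r, i) + b * A $$ (r, j) = 0"
    by (auto simp: cols_dependent_pair)
  show False
  proof (cases "i < j")
    case True
    then show False using assms[of i j a b] ab ij by auto
  next
    case False
    then show False using assms[of j i b a] ab ij by (auto simp: add.commute)
  qed
qed

lemma pairwise_independent_cols_no_zero_col:
  assumes "pairwise_independent_cols A" "2 \<le> dim_col A"
  shows "no_zero_col A"
  unfolding no_zero_col_def
proof (intro allI impI)
  fix i assume i: "i < dim_col A"
  define j where "j = (if i = 0 then 1 else 0 :: nat)"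
  have "j < dim_col A" "j \<noteq> i" using assms(2) by (auto simp: j_def)
  then have "\<not> cols_dependent A {i}"
    using cols_dependent_mono_pair[of A i j] assms(1) i unfolding pairwise_independent_cols_def by blast
  then show "col A i \<noteq> 0\<^sub>v (dim_row A)" using i by (simp add: cols_dependent_single_iff_zero_col)
qed

section \<open>Points of projective space\<close>

lemma finite_proj_points [simp]: "finite (proj_points m :: 'a::{field,finite} vec set set)"
proof -
  have "proj_points m \<subseteq> line_through ` (carrier_vec m :: 'a vec set)"
    unfolding proj_points_def by auto
  then show ?thesis by (rule finite_subset) simp
qed

text \<open>Every point contains all but one of the scalar multiples of a spanning vector as its nonzero
  vectors, and every nonzero vector lies on one point.\<close>

lemma card_proj_points:
  "card (proj_points m :: 'a::{field,finite} vec set set) * (CARD('a) - 1) = CARD('a) ^ m - 1"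
proof -
  let ?V = "{v :: 'a vec. v \<in> carrier_vec m \<and> v \<noteq> 0\<^sub>v m}"
  have im: "proj_points m = line_through ` ?V" unfolding proj_points_def by auto
  have finV: "finite ?V" by (rule finite_subset[of _ "carrier_vec m"]) auto
  have fiber: "card {w \<in> ?V. line_through w = P} = CARD('a) - 1" if "P \<in> line_through ` ?V" for P
  proof -
    from that obtain v where v: "v \<in> carrier_vec m" "v \<noteq> 0\<^sub>v m" "P = line_through v" by auto
    have nz: "c \<cdot>\<^sub>v v \<noteq> 0\<^sub>v m" if "c \<noteq> 0" for c using v that by (auto simp: vec_eq_iff)
    have "{w \<in> ?V. line_through w = P} = (\<lambda>c. c \<cdot>\<^sub>v v) ` (UNIV - {0})"
    proof (intro equalityI subsetI)
      fix w assume "w \<in> {w \<in> ?V. line_through w = P}"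
      then show "w \<in> (\<lambda>c. c \<cdot>\<^sub>v v) ` (UNIV - {0})"
        using v line_through_eq_iff[of w m v] by auto
    next
      fix w assume "w \<in> (\<lambda>c. c \<cdot>\<^sub>v v) ` (UNIV - {0})"
      then obtain c where "c \<noteq> 0" "w = c \<cdot>\<^sub>v v" by blast
      then show "w \<in> {w \<in> ?V. line_through w = P}"
        using v nz[of c] line_through_eq_iff[of w m v] by auto
    qed
    moreover have "inj_on (\<lambda>c. c \<cdot>\<^sub>v v) (UNIV - {0})"
    proof (rule inj_onI)
      fix c d assume "c \<cdot>\<^sub>v v = d \<cdot>\<^sub>v v"
      then have "(c - d) \<cdot>\<^sub>v v = 0\<^sub>v m" using v by (auto simp: vec_eq_iff algebra_simps)
      then show "c = d" using nz[of "c - d"] by auto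
    qed
    ultimately show ?thesis by (simp add: card_image card_Diff_singleton)
  qed
  have "card ?V = (\<Sum>P\<in>line_through ` ?V. card {w \<in> ?V. line_through w = P})"
    using sum.image_gen[OF finV, of "\<lambda>_. 1::nat" line_through] by simp
  also have "\<dots> = card (line_through ` ?V) * (CARD('a) - 1)" using fiber by simp
  finally have "card (line_through ` ?V) * (CARD('a) - 1) = card ?V" by simp
  moreover have "card ?V = CARD('a) ^ m - 1"
  proof -
    have "?V = carrier_vec m - {0\<^sub>v m}" by auto
    then show ?thesis by (simp add: card_carrier_vec card_Diff_singleton)
  qed
  ultimately show ?thesis unfolding im by simp
qed

lemma sum_appearances:
  fixes A :: "'a::{field,finite} mat"
  assumes A: "A \<in> carrier_mat m n" and nz: "no_zero_col A"
  shows "(\<Sum>P\<in>proj_points m. appearances A P) = n"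
proof -
  have fib: "appearances A P = card {j \<in> {..<n}. line_through (col A j) = P}" for P
    using A nz unfolding appearances_def no_zero_col_def by (intro arg_cong[where f=card]) auto
  have "(\<lambda>j. line_through (col A j)) ` {..<n} \<subseteq> proj_points m"
    using A nz unfolding proj_points_def no_zero_col_def by auto
  then show ?thesis
    using sum.group[of "{..<n}" "proj_points m" "\<lambda>j. line_through (col A j)" "\<lambda>_. 1::nat"]
    unfolding fib by simp
qed

section \<open>Counting the confounded interactions\<close>

lemma twice_choose_two: "2 * int (k choose 2) = int k * (int k - 1)"
proof -
  have "2 dvd k * (k - 1)" by (cases "even k") auto
  then have "2 * (k choose 2) = k * (k - 1)" unfolding choose_two by (rule dvd_mult_div_cancel)
  then have "2 * int (k choose 2) = int (k * (k - 1))" by (metis of_nat_mult of_nat_numeral)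
  then show ?thesis by (cases k) (auto simp: algebra_simps)
qed

text \<open>
  The chord of \<open>k \<mapsto> k (k - 1) / 2\<close> through the consecutive integers \<open>\<alpha>\<close> and \<open>\<alpha> + 1\<close> nowhere
  exceeds the function at an integer, because no integer lies strictly between them and so
  \<open>(k - \<alpha>) (k - \<alpha> - 1)\<close> is never negative.
\<close>

lemma choose_two_ge_linear:
  "int \<alpha> * int k - int (Suc \<alpha> choose 2) \<le> int (k choose 2)"
proof -
  have "0 \<le> (int k - int \<alpha>) * (int k - int \<alpha> - 1)"
    by (cases "k \<le> \<alpha>") (auto simp: zero_le_mult_iff)
  then have "0 \<le> 2 * int (k choose 2) + 2 * int (Suc \<alpha> choose 2) - 2 * (int \<alpha> * int k)"
    unfolding twice_choose_two by (simp add: algebra_simps)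
  then show ?thesis by simp
qed

lemma choose_two_eq_linear:
  assumes "k \<in> {\<alpha>, \<alpha> + 1}"
  shows "int (k choose 2) = int \<alpha> * int k - int (Suc \<alpha> choose 2)"
proof -
  have "(int k - int \<alpha>) * (int k - int \<alpha> - 1) = 0" using assms by auto
  then have "0 = 2 * int (k choose 2) + 2 * int (Suc \<alpha> choose 2) - 2 * (int \<alpha> * int k)"
    unfolding twice_choose_two by (simp add: algebra_simps)
  then show ?thesis by simp
qed

text \<open>
  Summing the chord bound over \<open>S\<close> gives a lower bound that depends on \<open>g\<close> only through its
  total, and a function with values \<open>\<alpha>\<close> and \<open>\<alpha> + 1\<close> attains it.
\<close>

lemma balanced_minimizes_pairs:
  fixes f g :: "'b \<Rightarrow> nat"
  assumes bal: "\<And>P. P \<in> S \<Longrightarrow> f P \<in> {\<alpha>, \<alpha> + 1}" and eq: "sum f S = sum g S"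
  shows "(\<Sum>P\<in>S. f P choose 2) \<le> (\<Sum>P\<in>S. g P choose 2)"
proof -
  have "int (\<Sum>P\<in>S. f P choose 2) = (\<Sum>P\<in>S. int \<alpha> * int (f P) - int (Suc \<alpha> choose 2))"
    using choose_two_eq_linear[OF bal] by simp
  also have "\<dots> = int \<alpha> * int (sum f S) - (\<Sum>P\<in>S. int (Suc \<alpha> choose 2))"
    by (simp add: sum_subtractf sum_distrib_left)
  also have "\<dots> = (\<Sum>P\<in>S. int \<alpha> * int (g P) - int (Suc \<alpha> choose 2))"
    unfolding eq by (simp add: sum_subtractf sum_distrib_left)
  also have "\<dots> \<le> (\<Sum>P\<in>S. int (g P choose 2))"
    by (intro sum_mono choose_two_ge_linear)
  finally have "int (\<Sum>P\<in>S. f P choose 2) \<le> int (\<Sum>P\<in>S. g P choose 2)" by simp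
  then show ?thesis by (simp only: of_nat_le_iff)
qed

text \<open>
  A pair with equal values lies inside exactly one fibre of \<open>f\<close>.
\<close>

lemma card_monochromatic_pairs:
  fixes f :: "nat \<Rightarrow> 'b"
  assumes "finite S" "f ` {..<n} \<subseteq> S"
  shows "card {A \<in> two_fis n. \<forall>i\<in>A. \<forall>j\<in>A. f i = f j} = (\<Sum>P\<in>S. card {j \<in> {..<n}. f j = P} choose 2)"
proof -
  let ?F = "\<lambda>P. {A. A \<subseteq> {j \<in> {..<n}. f j = P} \<and> card A = 2}"
  have "{A \<in> two_fis n. \<forall>i\<in>A. \<forall>j\<in>A. f i = f j} = (\<Union>P\<in>S. ?F P)"
  proof (intro equalityI subsetI)
    fix A assume "A \<in> {A \<in> two_fis n. \<forall>i\<in>A. \<forall>j\<in>A. f i = f j}"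
    then have A: "A \<subseteq> {..<n}" "card A = 2" and eq: "\<And>i j. i \<in> A \<Longrightarrow> j \<in> A \<Longrightarrow> f i = f j"
      unfolding two_fis_def by blast+
    from A have "A \<noteq> {}" by auto
    then obtain i where i: "i \<in> A" by blast
    have "A \<subseteq> {j \<in> {..<n}. f j = f i}" using A(1) eq[OF _ i] by blast
    then have "A \<in> ?F (f i)" using A(2) by blast
    moreover have "f i \<in> S" using A(1) i assms(2) by blast
    ultimately show "A \<in> (\<Union>P\<in>S. ?F P)" by blast
  next
    fix A assume "A \<in> (\<Union>P\<in>S. ?F P)"
    then show "A \<in> {A \<in> two_fis n. \<forall>i\<in>A. \<forall>j\<in>A. f i = f j}" unfolding two_fis_def by blast
  qed
  also have "card \<dots> = (\<Sum>P\<in>S. card (?F P))"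
  proof (rule card_UN_disjoint)
    show "\<forall>P\<in>S. finite (?F P)" by auto
    show "\<forall>P\<in>S. \<forall>Q\<in>S. P \<noteq> Q \<longrightarrow> ?F P \<inter> ?F Q = {}"
    proof (intro ballI impI equals0I)
      fix P Q A assume "P \<noteq> Q" and A: "A \<in> ?F P \<inter> ?F Q"
      from A have "A \<noteq> {}" by auto
      then show False using A \<open>P \<noteq> Q\<close> by blast
    qed
  qed (fact assms(1))
  also have "\<dots> = (\<Sum>P\<in>S. card {j \<in> {..<n}. f j = P} choose 2)"
    by (intro sum.cong refl n_subsets) auto
  finally show ?thesis .
qed

lemma card_dependent_pairs:
  fixes T :: "'a::{field,finite} mat"
  assumes T: "T \<in> carrier_mat m n" and nz: "no_zero_col T"
  shows "card {A \<in> two_fis n. cols_dependent T A} = (\<Sum>P\<in>proj_points m. appearances T P choose 2)"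
proof -
  let ?f = "\<lambda>j. line_through (col T j)"
  have "{A \<in> two_fis n. cols_dependent T A} = {A \<in> two_fis n. \<forall>i\<in>A. \<forall>j\<in>A. ?f i = ?f j}"
  proof (intro Collect_cong conj_cong refl)
    fix A assume "A \<in> two_fis n"
    then obtain i j where A: "A = {i, j}" "i \<noteq> j" "i < n" "j < n"
      by (auto simp: two_fis_def card_2_iff)
    show "cols_dependent T A \<longleftrightarrow> (\<forall>i\<in>A. \<forall>j\<in>A. ?f i = ?f j)"
      using cols_dependent_pair_iff_same_point[of i j T] A T nz
      unfolding no_zero_col_def by auto
  qed
  moreover have "?f ` {..<n} \<subseteq> proj_points m"
    using T nz unfolding proj_points_def no_zero_col_def by auto
  moreover have "appearances T P = card {j \<in> {..<n}. ?f j = P}" for P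
    using T nz unfolding appearances_def no_zero_col_def by (intro arg_cong[where f=card]) auto
  ultimately show ?thesis
    using card_monochromatic_pairs[of "proj_points m" ?f n] by simp
qed

lemma finite_two_fis [simp]: "finite (two_fis n)"
  unfolding two_fis_def by simp

lemma main_effects_unconfounded_top_nonzero:
  assumes "main_effects_unconfounded p n G" "G \<in> carrier_mat m n"
  shows "no_zero_col (top_rows p G)"
  unfolding no_zero_col_def
proof (intro allI impI)
  fix j assume j: "j < dim_col (top_rows p G)"
  then have "{j} \<in> main_effects n" using assms(2) by (auto simp: main_effects_def top_rows_def)
  then have "\<not> cols_dependent (top_rows p G) {j}"
    using assms(1) unfolding main_effects_unconfounded_def unconfounded_def
      confounded_with_columns_def by blast
  then show "col (top_rows p G) j \<noteq> 0\<^sub>v (dim_row (top_rows p G))"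
    using j by (simp add: cols_dependent_single_iff_zero_col)
qed

text \<open>
  Confounding with row effects and with other effects can only lower the count further.
\<close>

lemma num_unconfounded_le:
  "num_unconfounded_2fis p n G \<le> card {A \<in> two_fis n. \<not> cols_dependent (top_rows p G) A}"
  unfolding num_unconfounded_2fis_def unconfounded_def confounded_with_columns_def
  by (intro card_mono) auto

lemma nonsingular_not_cols_dependent:
  fixes G :: "'a::field mat"
  assumes G: "G \<in> carrier_mat n n" and det: "det G \<noteq> 0" and K: "K \<subseteq> {..<n}"
  shows "\<not> cols_dependent G K"
proof
  assume "cols_dependent G K"
  then obtain c k where k: "k \<in> K" "c k \<noteq> 0"
    and c: "\<And>i. i < n \<Longrightarrow> (\<Sum>k\<in>K. c k * G $$ (i, k)) = 0"
    using G unfolding cols_dependent_def by auto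
  define v where "v = vec n (\<lambda>k. if k \<in> K then c k else 0)"
  have "G *\<^sub>v v = 0\<^sub>v n"
  proof (rule eq_vecI)
    fix i assume "i < dim_vec (0\<^sub>v n :: 'a vec)"
    then have i: "i < n" by simp
    have "(G *\<^sub>v v) $ i = (\<Sum>k\<in>{0..<n}. G $$ (i, k) * (if k \<in> K then c k else 0))"
      using G i by (auto simp: scalar_prod_def v_def intro!: sum.cong)
    also have "\<dots> = (\<Sum>k\<in>{0..<n}. if k \<in> K then c k * G $$ (i, k) else 0)"
      by (intro sum.cong) auto
    also have "\<dots> = (\<Sum>k\<in>{0..<n} \<inter> K. c k * G $$ (i, k))"
      by (simp add: sum.inter_restrict)
    also have "{0..<n} \<inter> K = K" using K by auto
    finally show "(G *\<^sub>v v) $ i = 0\<^sub>v n $ i" using c i by simp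
  qed (use G in auto)
  moreover have "v \<in> carrier_vec n" by (simp add: v_def)
  moreover have "v $ k \<noteq> 0\<^sub>v n $ k" using k K by (auto simp: v_def)
  ultimately show False using det det_0_iff_vec_prod_zero_field[OF G] by blast
qed

text \<open>
  For a full factorial design the columns of the generator are linearly independent, so no two
  effects are confounded with each other; only confounding with rows and columns remains.
\<close>

lemma unconfounded_nonsingular_iff:
  fixes G :: "'a::field mat"
  assumes "G \<in> carrier_mat n n" "det G \<noteq> 0" "A \<subseteq> {..<n}"
  shows "unconfounded p n G A \<longleftrightarrow>
    \<not> cols_dependent (top_rows p G) A \<and> \<not> cols_dependent (bottom_rows p G) A"
proof -
  have "\<not> confounded_with G A B" if "B \<in> main_effects n \<union> two_fis n" for B
    using that assms(3) nonsingular_not_cols_dependent[OF assms(1,2), of "A \<union> B"]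
    by (auto simp: confounded_with_def main_effects_def two_fis_def)
  then show ?thesis
    unfolding unconfounded_def confounded_with_columns_def confounded_with_rows_def by blast
qed

lemma array_generator_nonsingular:
  fixes G :: "'a::field mat"
  assumes "1 \<le> p" "1 \<le> q" and G: "G \<in> carrier_mat (p + q) (p + q)" and "det G \<noteq> 0"
  shows "array_generator p q (p + q) G"
  using assms vec_space.det_rank_iff[OF G] by (simp add: array_generator_def)

lemma main_effects_unconfounded_nonsingular:
  fixes G :: "'a::field mat"
  assumes G: "G \<in> carrier_mat n n" and det: "det G \<noteq> 0"
    and nz: "no_zero_col (top_rows p G)" "no_zero_col (bottom_rows p G)"
  shows "main_effects_unconfounded p n G"
  unfolding main_effects_unconfounded_def
proof
  fix A assume "A \<in> main_effects n"
  then obtain j where A: "A = {j}" "j < n" by (auto simp: main_effects_def card_1_singleton_iff)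
  have "j < dim_col (top_rows p G)" "j < dim_col (bottom_rows p G)"
    using A G by (simp_all add: top_rows_def bottom_rows_def)
  then have "\<not> cols_dependent (top_rows p G) {j}" "\<not> cols_dependent (bottom_rows p G) {j}"
    using nz unfolding no_zero_col_def by (simp_all add: cols_dependent_single_iff_zero_col)
  then show "unconfounded p n G A"
    using unconfounded_nonsingular_iff[OF G det, of A p] A by auto
qed

text \<open>
  Independence in the bottom part means that no interaction is confounded with row effects, so the
  unconfounded interactions of \<open>G\<close> are precisely the pairs of factors at different top points. For
  any competitor these pairs are an upper bound. Both top parts distribute \<open>p + q\<close> nonzero columns
  over the same points, and the balanced distribution has the fewest coincident pairs.
\<close>

theorem two_fi_optimal_if_balanced:
  fixes G :: "'a::{field,finite} mat"
  assumes pq: "1 \<le> p" "1 \<le> q" and G: "G \<in> carrier_mat (p + q) (p + q)" and det: "det G \<noteq> 0"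
    and top_nz: "no_zero_col (top_rows p G)"
    and bottom: "pairwise_independent_cols (bottom_rows p G)"
    and bal: "\<And>P. P \<in> proj_points p \<Longrightarrow> appearances (top_rows p G) P \<in> {\<alpha>, \<alpha> + 1}"
  shows "two_fi_optimal p q (p + q) G"
  unfolding two_fi_optimal_def
proof (intro conjI allI impI)
  let ?n = "p + q"
  show "array_generator p q ?n G" using array_generator_nonsingular[OF pq G det] .
  have "2 \<le> dim_col (bottom_rows p G)" using pq G by (simp add: bottom_rows_def)
  then have "no_zero_col (bottom_rows p G)"
    by (rule pairwise_independent_cols_no_zero_col[OF bottom])
  then show "main_effects_unconfounded p ?n G"
    using main_effects_unconfounded_nonsingular[OF G det top_nz] by blast
  fix G' :: "'a mat"
  assume G': "array_generator p q ?n G' \<and> main_effects_unconfounded p ?n G'"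
  let ?dep = "\<lambda>G. {A \<in> two_fis ?n. cols_dependent (top_rows p G) A}"
  let ?ind = "\<lambda>G. {A \<in> two_fis ?n. \<not> cols_dependent (top_rows p G) A}"
  have G'_carrier: "G' \<in> carrier_mat ?n ?n" using G' by (simp add: array_generator_def)
  then have nz': "no_zero_col (top_rows p G')"
    using G' main_effects_unconfounded_top_nonzero by blast
  have T: "top_rows p G \<in> carrier_mat p ?n" "top_rows p G' \<in> carrier_mat p ?n"
    using G G'_carrier by auto
  have split: "card (?ind G) + card (?dep G) = card (two_fis ?n)" for G :: "'a mat"
    by (subst card_Un_disjoint[symmetric]) (auto intro: arg_cong[where f=card])
  have "card (?dep G) \<le> card (?dep G')"
    unfolding card_dependent_pairs[OF T(1) top_nz] card_dependent_pairs[OF T(2) nz']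
    by (rule balanced_minimizes_pairs[OF bal])
      (simp_all add: sum_appearances[OF T(1) top_nz] sum_appearances[OF T(2) nz'])
  then have "card (?ind G') \<le> card (?ind G)"
    using split[of G] split[of G'] by linarith
  moreover have "num_unconfounded_2fis p ?n G = card (?ind G)"
    unfolding num_unconfounded_2fis_def
  proof (intro arg_cong[where f=card] Collect_cong conj_cong refl)
    fix A assume "A \<in> two_fis ?n"
    then obtain i j where A: "A = {i, j}" "i \<noteq> j" "i < ?n" "j < ?n"
      by (auto simp: two_fis_def card_2_iff)
    have "\<not> cols_dependent (bottom_rows p G) A"
      using bottom A G unfolding pairwise_independent_cols_def by (auto simp: bottom_rows_def)
    then show "unconfounded p ?n G A \<longleftrightarrow> \<not> cols_dependent (top_rows p G) A"
      using unconfounded_nonsingular_iff[OF G det, of A p] A by auto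
  qed
  ultimately show "num_unconfounded_2fis p ?n G' \<le> num_unconfounded_2fis p ?n G"
    using num_unconfounded_le[of p ?n G'] by linarith
qed

section \<open>Balanced completions\<close>

text \<open>
  The cyclic distribution of \<open>n\<close> objects over \<open>N\<close> places is balanced.
\<close>

lemma card_residue_class:
  assumes "t < (N::nat)"
  shows "card {j. j < n \<and> j mod N = t} \<in> {n div N, n div N + 1}"
proof -
  let ?m = "n div N + (if t < n mod N then 1 else 0)"
  have "{j. j < n \<and> j mod N = t} = (\<lambda>k. k * N + t) ` {..<?m}"
  proof (intro equalityI subsetI)
    fix j assume "j \<in> {j. j < n \<and> j mod N = t}"
    then have j: "j < n" "j mod N = t" by auto
    have eq: "j = (j div N) * N + t" "n = n div N * N + n mod N" using j by (metis div_mult_mod_eq)+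
    have "j div N \<le> n div N" using j by (simp add: div_le_mono)
    moreover have "t < n mod N" if "j div N = n div N" using eq j that by (metis nat_add_left_cancel_less)
    ultimately have "j div N < ?m" by (auto simp: le_less)
    then show "j \<in> (\<lambda>k. k * N + t) ` {..<?m}" using eq(1) by blast
  next
    fix j assume "j \<in> (\<lambda>k. k * N + t) ` {..<?m}"
    then obtain k where k: "k < ?m" "j = k * N + t" by auto
    have "j < n"
    proof (cases "k < n div N")
      case True
      then have "Suc k * N \<le> n div N * N" by (intro mult_le_mono1) simp
      then have "Suc k * N \<le> n" using div_mult_mod_eq[of n N] by linarith
      then show ?thesis using k assms by simp
    next
      case False
      then have "k = n div N" and "t < n mod N" using k(1) by (auto split: if_splits)
      have "n div N * N + t < n" using \<open>t < n mod N\<close> div_mult_mod_eq[of n N] by linarith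
      then show ?thesis using k(2) \<open>k = n div N\<close> by simp
    qed
    then show "j \<in> {j. j < n \<and> j mod N = t}" using k assms by simp
  qed
  moreover have "inj_on (\<lambda>k. k * N + t) {..<?m}" using assms by (auto intro!: inj_onI)
  ultimately show ?thesis by (simp add: card_image)
qed

text \<open>
  Distribute all columns cyclically over a list of the points. The columns of \<open>W\<close> are fixed in
  advance, but they represent distinct points, so the list can be chosen to begin with them.
\<close>

lemma ex_balanced_completion:
  fixes W :: "'a::{field,finite} mat"
  assumes W: "W \<in> carrier_mat p m" and nz: "no_zero_col W" and ind: "pairwise_independent_cols W"
    and m: "0 < m"
  shows "\<exists>Y \<in> carrier_mat p k. no_zero_col Y \<and>
    (\<forall>P \<in> proj_points p. appearances (W @\<^sub>c Y) P \<in>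
      {(m + k) div card (proj_points p :: 'a vec set set),
       (m + k) div card (proj_points p :: 'a vec set set) + 1})"
proof -
  let ?PG = "proj_points p :: 'a vec set set"
  let ?N = "card ?PG"
  let ?w = "\<lambda>j. line_through (col W j)"
  have w_in: "?w j \<in> ?PG" if "j < m" for j
    using W nz that unfolding proj_points_def no_zero_col_def by auto
  have inj: "inj_on ?w {..<m}"
    using W nz ind cols_dependent_pair_iff_same_point[of _ _ W]
    unfolding inj_on_def pairwise_independent_cols_def no_zero_col_def
    by (metis carrier_matD(2) lessThan_iff)
  \<comment> \<open>list the points, beginning with those of the columns of \<open>W\<close>\<close>
  obtain rest where rest: "distinct rest" "set rest = ?PG - ?w ` {..<m}"
    using finite_distinct_list[of "?PG - ?w ` {..<m}"] by auto
  define ps where "ps = map ?w [0..<m] @ rest"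
  have ps: "set ps = ?PG" "distinct ps"
    using rest w_in inj by (auto simp: ps_def distinct_map atLeast0LessThan)
  then have len: "length ps = ?N" using distinct_card by metis
  have mN: "m \<le> ?N" unfolding len[symmetric] by (simp add: ps_def)
  then have N0: "0 < ?N" using m by simp
  have nth_w: "ps ! j = ?w j" if "j < m" for j using that by (simp add: ps_def nth_append)
  have ps_in: "ps ! (j mod ?N) \<in> ?PG" for j
    using N0 len ps(1) nth_mem[of "j mod ?N" ps] by auto
  have "\<exists>v. v \<in> carrier_vec p \<and> v \<noteq> 0\<^sub>v p \<and> line_through v = ps ! (j mod ?N)" for j
    using ps_in[of j] unfolding proj_points_def by auto
  then obtain v where v: "\<And>j. v j \<in> carrier_vec p" "\<And>j. v j \<noteq> 0\<^sub>v p"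
    "\<And>j. line_through (v j) = ps ! (j mod ?N)" by metis
  \<comment> \<open>and run through that list cyclically\<close>
  define Y where "Y = mat p k (\<lambda>(i, j). v (m + j) $ i)"
  have Y: "Y \<in> carrier_mat p k" by (simp add: Y_def)
  have colY: "col Y j = v (m + j)" if "j < k" for j
    using that v(1)[of "m + j"] by (intro eq_vecI) (auto simp: Y_def)
  have nzY: "no_zero_col Y" using Y v(2) by (auto simp: no_zero_col_def colY)
  have col_nz: "col (W @\<^sub>c Y) j \<noteq> 0\<^sub>v p" if "j < m + k" for j
    using that W Y nz v(2) by (auto simp: col_append_cols[OF W Y] colY no_zero_col_def)
  have point: "line_through (col (W @\<^sub>c Y) j) = ps ! (j mod ?N)" if "j < m + k" for j
    using that mN by (auto simp: col_append_cols[OF W Y] colY v(3) nth_w)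
  have "appearances (W @\<^sub>c Y) P \<in> {(m + k) div ?N, (m + k) div ?N + 1}" if P: "P \<in> ?PG" for P
  proof -
    obtain t where t: "t < ?N" "ps ! t = P" using P ps(1) len by (metis in_set_conv_nth)
    have "appearances (W @\<^sub>c Y) P = card {j. j < m + k \<and> j mod ?N = t}"
      unfolding appearances_def
    proof (intro arg_cong[where f=card] Collect_cong)
      fix j
      have "j mod ?N < length ps" "t < length ps" using N0 t len by auto
      then have "ps ! (j mod ?N) = P \<longleftrightarrow> j mod ?N = t"
        using ps(2) t(2) nth_eq_iff_index_eq by blast
      then show "j < dim_col (W @\<^sub>c Y) \<and> col (W @\<^sub>c Y) j \<noteq> 0\<^sub>v (dim_row (W @\<^sub>c Y)) \<and>
          line_through (col (W @\<^sub>c Y) j) = P \<longleftrightarrow> j < m + k \<and> j mod ?N = t"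
        using col_nz[of j] point[of j] W Y by auto
    qed
    then show ?thesis using card_residue_class[OF t(1), of "m + k"] by simp
  qed
  then show ?thesis using Y nzY by blast
qed

text \<open>
  The number of points is \<open>(s ^ p - 1) / (s - 1)\<close>, so the quotient by it is
  \<open>(p + q) (s - 1) div (s ^ p - 1)\<close>.
\<close>

lemma ex_balanced_third_block:
  fixes A :: "'a::{field,finite} mat"
  assumes pq: "1 \<le> p" "p \<le> q" and A: "A \<in> carrier_mat p p"
    and ind: "pairwise_independent_cols (1\<^sub>m p @\<^sub>c A)"
  shows "\<exists>Y \<in> carrier_mat p (q - p). no_zero_col Y \<and>
    (\<forall>P \<in> proj_points p. appearances (1\<^sub>m p @\<^sub>c A @\<^sub>c Y) P \<in>
      {(p + q) * (CARD('a) - 1) div (CARD('a) ^ p - 1), (p + q) * (CARD('a) - 1) div (CARD('a) ^ p - 1) + 1})"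
proof -
  let ?N = "card (proj_points p :: 'a vec set set)"
  have W: "1\<^sub>m p @\<^sub>c A \<in> carrier_mat p (p + p)" using A by simp
  have "2 \<le> p + p" using pq(1) by linarith
  then have "no_zero_col (1\<^sub>m p @\<^sub>c A)"
    by (intro pairwise_independent_cols_no_zero_col[OF ind]) (simp only: carrier_matD(2)[OF W])
  then obtain Y where Y: "Y \<in> carrier_mat p (q - p)" "no_zero_col Y"
    "\<And>P. P \<in> proj_points p \<Longrightarrow> appearances ((1\<^sub>m p @\<^sub>c A) @\<^sub>c Y) P
      \<in> {(p + p + (q - p)) div ?N, (p + p + (q - p)) div ?N + 1}"
    using ex_balanced_completion[OF W _ ind, of "q - p"] pq by auto
  have "CARD('a) \<ge> 2"
    using card_mono[of UNIV "{0, 1 :: 'a}"] by simp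
  then have "(p + q) * (CARD('a) - 1) div (CARD('a) ^ p - 1) = (p + q) div ?N"
    unfolding card_proj_points[symmetric] by (simp add: div_mult_mult2)
  moreover have "p + p + (q - p) = p + q" using pq by simp
  moreover have "(1\<^sub>m p @\<^sub>c A) @\<^sub>c Y = 1\<^sub>m p @\<^sub>c A @\<^sub>c Y"
    using append_cols_assoc[of "1\<^sub>m p" p p A p Y] A Y(1) by simp
  ultimately show ?thesis using Y by metis
qed

section \<open>Block generators\<close>

text \<open>
  The common shape of the generators for two and for at least three top rows. The columns in the last
  block have unit vectors as bottom parts, so their top parts \<open>Y\<close> are free to balance the points.
\<close>

definition block_generator :: "nat \<Rightarrow> nat \<Rightarrow> 'a::field mat \<Rightarrow> 'a mat \<Rightarrow> 'a mat \<Rightarrow> 'a mat \<Rightarrow> 'a mat" where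
  "block_generator p q A C D Y =
     (1\<^sub>m p @\<^sub>c A @\<^sub>c Y) @\<^sub>r
     (C @\<^sub>c D @\<^sub>c 0\<^sub>m p (q - p)) @\<^sub>r
     (0\<^sub>m (q - p) p @\<^sub>c 0\<^sub>m (q - p) p @\<^sub>c 1\<^sub>m (q - p))"

context
  fixes p q :: nat and A C D Y :: "'a::field mat"
  assumes pq: "1 \<le> p" "p \<le> q"
    and car: "A \<in> carrier_mat p p" "C \<in> carrier_mat p p" "D \<in> carrier_mat p p" "Y \<in> carrier_mat p (q - p)"
begin

lemma block_generator_rows:
  shows "top_rows p (block_generator p q A C D Y) = 1\<^sub>m p @\<^sub>c A @\<^sub>c Y"
    and "bottom_rows p (block_generator p q A C D Y) =
      (C @\<^sub>c D @\<^sub>c 0\<^sub>m p (q - p)) @\<^sub>r (0\<^sub>m (q - p) p @\<^sub>c 0\<^sub>m (q - p) p @\<^sub>c 1\<^sub>m (q - p))"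
    and "block_generator p q A C D Y \<in> carrier_mat (p + q) (p + q)"
proof -
  let ?n = "p + (p + (q - p))"
  have T: "1\<^sub>m p @\<^sub>c A @\<^sub>c Y \<in> carrier_mat p ?n"
    and M: "C @\<^sub>c D @\<^sub>c 0\<^sub>m p (q - p) \<in> carrier_mat p ?n"
    and L: "0\<^sub>m (q - p) p @\<^sub>c 0\<^sub>m (q - p) p @\<^sub>c 1\<^sub>m (q - p) \<in> carrier_mat (q - p) ?n"
    using car by (intro append_cols_carrier; simp)+
  show "top_rows p (block_generator p q A C D Y) = 1\<^sub>m p @\<^sub>c A @\<^sub>c Y"
    unfolding block_generator_def by (rule top_rows_append_rows[OF T carrier_append_rows[OF M L]])
  show "bottom_rows p (block_generator p q A C D Y) =
      (C @\<^sub>c D @\<^sub>c 0\<^sub>m p (q - p)) @\<^sub>r (0\<^sub>m (q - p) p @\<^sub>c 0\<^sub>m (q - p) p @\<^sub>c 1\<^sub>m (q - p))"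
    unfolding block_generator_def by (rule bottom_rows_append_rows[OF T carrier_append_rows[OF M L]])
  show "block_generator p q A C D Y \<in> carrier_mat (p + q) (p + q)"
    using carrier_append_rows[OF T carrier_append_rows[OF M L]] pq
    unfolding block_generator_def by simp
qed

text \<open>
  The condition on \<open>D\<close> says that the Schur complement \<open>D - C A\<close> of the leading identity block is
  the identity. A vector in the kernel has last block zero by the last rows; then the Schur
  complement annihilates its middle block, and the first rows annihilate its first block.
\<close>

lemma det_block_generator_nonzero:
  assumes D: "D = C * A + 1\<^sub>m p"
  shows "det (block_generator p q A C D Y) \<noteq> 0"
proof
  let ?n = "p + (p + (q - p))"
  have n: "?n = p + q" using pq by simp
  assume "det (block_generator p q A C D Y) = 0"
  then obtain v where v: "v \<in> carrier_vec ?n" "v \<noteq> 0\<^sub>v ?n" "block_generator p q A C D Y *\<^sub>v v = 0\<^sub>v (p + q)"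
    using det_0_iff_vec_prod_zero_field[OF block_generator_rows(3)] unfolding n by blast
  define x y z where "x = vec_first v p" and "y = vec_first (vec_last v (p + (q - p))) p"
    and "z = vec_last (vec_last v (p + (q - p))) (q - p)"
  have xyz: "x \<in> carrier_vec p" "y \<in> carrier_vec p" "z \<in> carrier_vec (q - p)"
    by (simp_all add: x_def y_def z_def)
  have v_eq: "v = x @\<^sub>v (y @\<^sub>v z)" using v(1) by (simp add: x_def y_def z_def)
  have T: "1\<^sub>m p @\<^sub>c A @\<^sub>c Y \<in> carrier_mat p ?n"
    and M: "C @\<^sub>c D @\<^sub>c 0\<^sub>m p (q - p) \<in> carrier_mat p ?n"
    and L: "0\<^sub>m (q - p) p @\<^sub>c 0\<^sub>m (q - p) p @\<^sub>c 1\<^sub>m (q - p) \<in> carrier_mat (q - p) ?n"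
    using car by (intro append_cols_carrier; simp)+
  have "0\<^sub>v (p + q) = (1\<^sub>m p @\<^sub>c A @\<^sub>c Y) *\<^sub>v v @\<^sub>v ((C @\<^sub>c D @\<^sub>c 0\<^sub>m p (q - p)) *\<^sub>v v @\<^sub>v
      (0\<^sub>m (q - p) p @\<^sub>c 0\<^sub>m (q - p) p @\<^sub>c 1\<^sub>m (q - p)) *\<^sub>v v)"
    using v(3) unfolding block_generator_def
      mat_mult_append[OF T carrier_append_rows[OF M L] v(1)] mat_mult_append[OF M L v(1)] by simp
  moreover have "0\<^sub>v (p + q) = 0\<^sub>v p @\<^sub>v (0\<^sub>v p @\<^sub>v 0\<^sub>v (q - p))"
    unfolding n[symmetric] by (intro eq_vecI) auto
  ultimately have split: "(1\<^sub>m p @\<^sub>c A @\<^sub>c Y) *\<^sub>v v @\<^sub>v ((C @\<^sub>c D @\<^sub>c 0\<^sub>m p (q - p)) *\<^sub>v v @\<^sub>v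
      (0\<^sub>m (q - p) p @\<^sub>c 0\<^sub>m (q - p) p @\<^sub>c 1\<^sub>m (q - p)) *\<^sub>v v) = 0\<^sub>v p @\<^sub>v (0\<^sub>v p @\<^sub>v 0\<^sub>v (q - p))"
    by (rule subst)
  then have top: "(1\<^sub>m p @\<^sub>c A @\<^sub>c Y) *\<^sub>v v = 0\<^sub>v p"
    and rest: "(C @\<^sub>c D @\<^sub>c 0\<^sub>m p (q - p)) *\<^sub>v v @\<^sub>v
      (0\<^sub>m (q - p) p @\<^sub>c 0\<^sub>m (q - p) p @\<^sub>c 1\<^sub>m (q - p)) *\<^sub>v v = 0\<^sub>v p @\<^sub>v 0\<^sub>v (q - p)"
    using append_vec_eq[OF mult_mat_vec_carrier[OF T v(1)] zero_carrier_vec] by blast+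
  from rest have mid: "(C @\<^sub>c D @\<^sub>c 0\<^sub>m p (q - p)) *\<^sub>v v = 0\<^sub>v p"
    and low: "(0\<^sub>m (q - p) p @\<^sub>c 0\<^sub>m (q - p) p @\<^sub>c 1\<^sub>m (q - p)) *\<^sub>v v = 0\<^sub>v (q - p)"
    using append_vec_eq[OF mult_mat_vec_carrier[OF M v(1)] zero_carrier_vec] by blast+
  have mult3: "(E @\<^sub>c F @\<^sub>c H) *\<^sub>v v = E *\<^sub>v x + (F *\<^sub>v y + H *\<^sub>v z)"
    if "E \<in> carrier_mat r p" "F \<in> carrier_mat r p" "H \<in> carrier_mat r (q - p)" for E F H :: "'a mat" and r
    unfolding v_eq using that xyz
    by (simp add: mult_vec_append_cols[OF that(1) append_cols_carrier[OF that(2,3)]]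
        mult_vec_append_cols[OF that(2,3)])
  have zero_mult: "0\<^sub>m r c *\<^sub>v w = 0\<^sub>v r" if "w \<in> carrier_vec c" for r c and w :: "'a vec"
    using that by (intro eq_vecI) auto
  have "z = 0\<^sub>v (q - p)"
    using low xyz by (subst (asm) mult3[of _ "q - p"]) (simp_all add: zero_mult)
  have Ay: "A *\<^sub>v y \<in> carrier_vec p" using car xyz by simp
  have "Y *\<^sub>v z = 0\<^sub>v p" using car unfolding \<open>z = 0\<^sub>v (q - p)\<close> by (intro eq_vecI) auto
  then have x: "x + A *\<^sub>v y = 0\<^sub>v p"
    using top xyz car Ay by (subst (asm) mult3[of _ p]) simp_all
  have "C *\<^sub>v x + D *\<^sub>v y = 0\<^sub>v p"
    using mid xyz car by (subst (asm) mult3[of _ p]) (simp_all add: zero_mult)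
  \<comment> \<open>subtract \<open>C\<close> times the first block row from the second\<close>
  moreover have "D *\<^sub>v y = C *\<^sub>v (A *\<^sub>v y) + y"
    unfolding D using car xyz by (simp add: add_mult_distrib_mat_vec[of _ p p] assoc_mult_mat_vec[of _ p p])
  moreover have "C *\<^sub>v x + C *\<^sub>v (A *\<^sub>v y) = C *\<^sub>v (x + A *\<^sub>v y)"
    using car xyz Ay by (simp add: mult_add_distrib_mat_vec[of _ p p])
  moreover have "C *\<^sub>v 0\<^sub>v p = 0\<^sub>v p" using car by (intro eq_vecI) auto
  ultimately have "y = 0\<^sub>v p"
    using x car xyz Ay by (simp add: assoc_add_vec[of _ p, symmetric])
  moreover have "A *\<^sub>v 0\<^sub>v p = 0\<^sub>v p" using car by (intro eq_vecI) auto
  ultimately have "x = 0\<^sub>v p" using x xyz by simp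
  with \<open>y = 0\<^sub>v p\<close> \<open>z = 0\<^sub>v (q - p)\<close> have "v = 0\<^sub>v ?n" unfolding v_eq by (intro eq_vecI) auto
  with v(2) show False by contradiction
qed

text \<open>
  The bottom parts of the last block of columns are unit vectors in rows where the other bottom parts
  vanish, so only pairs among the columns of \<open>(C D)\<close> could be dependent.
\<close>

lemma block_generator_bottom_independent:
  assumes ind: "pairwise_independent_cols (C @\<^sub>c D)"
  shows "pairwise_independent_cols (bottom_rows p (block_generator p q A C D Y))"
proof (rule pairwise_independent_colsI)
  let ?CD = "C @\<^sub>c D"
  let ?B = "bottom_rows p (block_generator p q A C D Y)"
  have dim: "dim_row ?B = q" "dim_col ?B = p + q" using block_generator_rows(3) by (auto simp: bottom_rows_def)
  have upper: "?B $$ (r, j) = (if j < 2 * p then ?CD $$ (r, j) else 0)" if "r < p" "j < p + q" for r j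
    unfolding block_generator_rows(2) using that car pq by auto
  have lower: "?B $$ (p + r, j) = (if j = 2 * p + r then 1 else 0)" if "r < q - p" "j < p + q" for r j
    unfolding block_generator_rows(2) using that car pq by auto
  fix i j a b
  assume ij: "i < j" "j < dim_col ?B"
    and zero: "\<And>r. r < dim_row ?B \<Longrightarrow> a * ?B $$ (r, i) + b * ?B $$ (r, j) = 0"
  have b0: "b = 0" if "2 * p \<le> j"
    using zero[of "p + (j - 2 * p)"] lower[of "j - 2 * p" i] lower[of "j - 2 * p" j] that ij dim pq
    by auto
  show "a = 0 \<and> b = 0"
  proof (cases "2 * p \<le> i")
    case True
    then have "a = 0"
      using zero[of "p + (i - 2 * p)"] lower[of "i - 2 * p" i] lower[of "i - 2 * p" j] ij dim pq b0
      by auto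
    then show ?thesis using True b0 ij by simp
  next
    case i: False
    \<comment> \<open>when \<open>j\<close> lies outside the first two blocks, any other column of \<open>(C D)\<close> can replace it\<close>
    define j' where "j' = (if j < 2 * p then j else if i = 0 then 1 else 0)"
    have j': "j' < 2 * p" "j' \<noteq> i" using i ij pq by (auto simp: j'_def)
    have "a * ?CD $$ (r, i) + b * ?CD $$ (r, j') = 0" if "r < p" for r
      using zero[of r] upper[of r i] upper[of r j] that i ij dim pq b0 by (auto simp: j'_def split: if_splits)
    moreover have "\<not> cols_dependent ?CD {i, j'}"
      using ind j' i car unfolding pairwise_independent_cols_def by auto
    ultimately show ?thesis
      using j'(2) car by (subst (asm) cols_dependent_pair) auto
  qed
qed

end

theorem block_generator_optimal:
  fixes A C D Y :: "'s::prime_card mod_ring mat"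
  assumes pq: "1 \<le> p" "p \<le> q"
    and car: "A \<in> carrier_mat p p" "C \<in> carrier_mat p p" "D \<in> carrier_mat p p"
      "Y \<in> carrier_mat p (q - p)"
    and D: "D = C * A + 1\<^sub>m p"
    and ind: "pairwise_independent_cols (1\<^sub>m p @\<^sub>c A)" "pairwise_independent_cols (C @\<^sub>c D)"
    and Y: "no_zero_col Y"
    and bal: "\<And>P. P \<in> proj_points p \<Longrightarrow> appearances (1\<^sub>m p @\<^sub>c A @\<^sub>c Y) P \<in> {\<alpha>, \<alpha> + 1}"
  shows "yields_2fi_optimal_full_factorial p q (p + q) (block_generator p q A C D Y)"
proof -
  let ?G = "block_generator p q A C D Y"
  note rows = block_generator_rows[OF pq car]
  note det = det_block_generator_nonzero[OF pq car D]
  have W: "1\<^sub>m p @\<^sub>c A \<in> carrier_mat p (p + p)" using car by simp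
  have "2 \<le> p + p" using pq(1) by linarith
  then have "no_zero_col (1\<^sub>m p @\<^sub>c A)"
    by (intro pairwise_independent_cols_no_zero_col[OF ind(1)]) (simp only: carrier_matD(2)[OF W])
  then have "no_zero_col ((1\<^sub>m p @\<^sub>c A) @\<^sub>c Y)"
    using no_zero_col_append_cols[OF W car(4)] Y by blast
  then have "no_zero_col (1\<^sub>m p @\<^sub>c A @\<^sub>c Y)"
    using append_cols_assoc[of "1\<^sub>m p" p p A p Y] car by simp
  then have "two_fi_optimal p q (p + q) ?G"
    using pq rows det block_generator_bottom_independent[OF pq car ind(2)] bal
    by (intro two_fi_optimal_if_balanced[where \<alpha>=\<alpha>]) auto
  then show ?thesis
    using nonsingular_yields_full_factorial[OF rows(3) det]
    unfolding yields_2fi_optimal_full_factorial_def two_fi_optimal_def by blast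
qed

section \<open>Arrays with one top row\<close>

text \<open>
  With a single top row the projective space is one point. Every interaction is then confounded with
  column effects, whatever the generator, and optimality only concerns the main effects.
\<close>

lemma one_row_two_fis_confounded:
  fixes T :: "'a::field mat"
  assumes "dim_row T = 1" "A \<in> two_fis n"
  shows "cols_dependent T A"
proof -
  obtain i j where A: "A = {i, j}" "i \<noteq> j" using assms(2) by (auto simp: two_fis_def card_2_iff)
  let ?x = "T $$ (0, i)" and ?y = "T $$ (0, j)"
  show ?thesis
  proof (cases "?x = 0 \<and> ?y = 0")
    case True
    then have "\<forall>r<dim_row T. 1 * T $$ (r, i) + 1 * T $$ (r, j) = 0" using assms(1) by simp
    then show ?thesis unfolding A(1) cols_dependent_pair[OF A(2)] using zero_neq_one by metis
  next
    case False
    then have "?y \<noteq> 0 \<or> - ?x \<noteq> 0" by auto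
    moreover have "\<forall>r<dim_row T. ?y * T $$ (r, i) + (- ?x) * T $$ (r, j) = 0"
      using assms(1) by (simp add: mult.commute)
    ultimately show ?thesis unfolding A(1) cols_dependent_pair[OF A(2)] by blast
  qed
qed

lemma generator_a_index:
  assumes "i < 1 + q" "j < 1 + q"
  shows "generator_a q $$ (i, j) = 1 + (if i = j \<and> i \<noteq> 0 then 1 else 0)"
  using assms by (auto simp: generator_a_def ones_mat_def)

lemma generator_a_carrier: "generator_a q \<in> carrier_mat (1 + q) (1 + q)"
  by (auto simp: generator_a_def ones_mat_def)

text \<open>
  Every entry of the generator is 1 plus the entry of a partial identity matrix, so each row applied
  to a kernel vector gives the sum of its entries plus at most one entry. Row 0 shows
  that the sum vanishes, and then every other row isolates its own entry.
\<close>

lemma det_generator_a_nonzero: "det (generator_a q :: 'a::field mat) \<noteq> 0"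
proof
  let ?G = "generator_a q :: 'a mat"
  assume "det ?G = 0"
  then obtain v where v: "v \<in> carrier_vec (1 + q)" "v \<noteq> 0\<^sub>v (1 + q)" "?G *\<^sub>v v = 0\<^sub>v (1 + q)"
    using det_0_iff_vec_prod_zero_field[OF generator_a_carrier] by blast
  let ?s = "\<Sum>j<1 + q. v $ j"
  have mult: "?s + (if i = 0 then 0 else v $ i) = 0" if i: "i < 1 + q" for i
  proof -
    have "(?G *\<^sub>v v) $ i = (\<Sum>j<1 + q. ?G $$ (i, j) * v $ j)"
      using i v(1) generator_a_carrier[of q, where 'a='a]
      by (auto simp: scalar_prod_def atLeast0LessThan intro!: sum.cong)
    also have "\<dots> = (\<Sum>j<1 + q. v $ j + (if i = j then if i = 0 then 0 else v $ j else 0))"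
      using i by (intro sum.cong) (auto simp: generator_a_index algebra_simps)
    also have "\<dots> = ?s + (if i = 0 then 0 else v $ i)"
      using i by (simp only: sum.distrib sum.delta finite_lessThan) simp
    finally show ?thesis using v(3) i by simp
  qed
  have s: "?s = 0" using mult[of 0] by simp
  then have z: "v $ i = 0" if "i < 1 + q" "i \<noteq> 0" for i using mult[of i] that by simp
  have "?s = v $ 0 + (\<Sum>j\<in>{..<1 + q} - {0}. v $ j)" by (rule sum.remove) auto
  also have "\<dots> = v $ 0" using z by simp
  finally have "v $ 0 = 0" using s by simp
  then have "v $ i = 0" if "i < 1 + q" for i using z[of i] that by (cases "i = 0") auto
  then have "v = 0\<^sub>v (1 + q)" using v(1) by (intro eq_vecI) auto
  with v(2) show False by contradiction
qed

theorem generator_a_optimal: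
  fixes q :: nat
  assumes "1 \<le> q" "(2 :: 's::prime_card mod_ring) \<noteq> 0"
  shows "yields_2fi_optimal_full_factorial 1 q (1 + q) (generator_a q :: 's mod_ring mat)"
proof -
  let ?G = "generator_a q :: 's mod_ring mat"
  have car: "?G \<in> carrier_mat (1 + q) (1 + q)" and det: "det ?G \<noteq> 0"
    using generator_a_carrier det_generator_a_nonzero by blast+
  have top: "no_zero_col (top_rows 1 ?G)"
    using car by (intro no_zero_colI exI[of _ 0]) (auto simp: top_rows_def generator_a_index)
  have bottom: "no_zero_col (bottom_rows 1 ?G)"
    using car assms by (intro no_zero_colI exI[of _ 0]) (auto simp: bottom_rows_def generator_a_index)
  have zero: "num_unconfounded_2fis 1 (1 + q) G' = 0"
    for G' :: "'s mod_ring mat"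
  proof -
    have "{A \<in> two_fis (1 + q). \<not> cols_dependent (top_rows 1 G') A} = {}"
      using one_row_two_fis_confounded[of "top_rows 1 G'"] by (auto simp: top_rows_def)
    then show ?thesis using num_unconfounded_le[of 1 "1 + q" G'] by (simp only: card.empty le_zero_eq)
  qed
  have "two_fi_optimal 1 q (1 + q) ?G"
    unfolding two_fi_optimal_def zero
    using assms(1) array_generator_nonsingular[OF _ _ car det]
      main_effects_unconfounded_nonsingular[OF car det top bottom] by simp
  then show ?thesis
    using nonsingular_yields_full_factorial[OF car det]
    unfolding yields_2fi_optimal_full_factorial_def two_fi_optimal_def by blast
qed

section \<open>Arrays with two top rows\<close>

text \<open>
  The products differ exactly when a \<open>2 \<times> 2\<close> minor is nonzero, so Cramer's rule applies.
\<close>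

lemma pairwise_independent_cols_two_rows:
  fixes A :: "'a::field mat"
  assumes "dim_row A = 2"
    and minors: "\<And>i j. i < j \<Longrightarrow> j < dim_col A \<Longrightarrow> A $$ (0, i) * A $$ (1, j) \<noteq> A $$ (0, j) * A $$ (1, i)"
  shows "pairwise_independent_cols A"
proof (rule pairwise_independent_colsI)
  fix i j a b assume ij: "i < j" "j < dim_col A"
    and zero: "\<And>r. r < dim_row A \<Longrightarrow> a * A $$ (r, i) + b * A $$ (r, j) = 0"
  let ?d = "A $$ (0, i) * A $$ (1, j) - A $$ (0, j) * A $$ (1, i)"
  have z: "a * A $$ (0, i) + b * A $$ (0, j) = 0" "a * A $$ (1, i) + b * A $$ (1, j) = 0"
    using zero assms(1) by auto
  have "a * ?d = (a * A $$ (0, i) + b * A $$ (0, j)) * A $$ (1, j)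
      - (a * A $$ (1, i) + b * A $$ (1, j)) * A $$ (0, j)"
    by (simp add: algebra_simps)
  moreover have "b * ?d = (a * A $$ (1, i) + b * A $$ (1, j)) * A $$ (0, i)
      - (a * A $$ (0, i) + b * A $$ (0, j)) * A $$ (1, i)"
    by (simp add: algebra_simps)
  ultimately have "a * ?d = 0" "b * ?d = 0" unfolding z by simp_all
  then show "a = 0 \<and> b = 0" using minors[OF ij] by simp
qed

lemma M_mat_carrier: "M_mat \<in> carrier_mat 2 2"
  by (auto simp: M_mat_def mat_of_rows_list_def)

lemma M_mat_index:
  "M_mat $$ (0, 0) = 1" "M_mat $$ (0, Suc 0) = 1" "M_mat $$ (Suc 0, 0) = 2" "M_mat $$ (Suc 0, Suc 0) = 1"
  by (simp_all add: M_mat_def mat_of_rows_list_def)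

lemma pairs_below_four:
  assumes "i < j" "j < (4::nat)"
  shows "(i, j) \<in> {(0, 1), (0, 2), (0, 3), (1, 2), (1, 3), (2, 3)}"
  using assms by auto

lemma generator_b_blocks_independent:
  assumes two: "(2 :: 'a::field) \<noteq> 0"
  shows "pairwise_independent_cols (1\<^sub>m 2 @\<^sub>c M_mat :: 'a mat)"
    and "pairwise_independent_cols (1\<^sub>m 2 @\<^sub>c (M_mat + 1\<^sub>m 2) :: 'a mat)"
proof -
  have neq: "(2 :: 'a) \<noteq> 1" by (metis add_cancel_left_left one_add_one zero_neq_one)
  have four: "(4 :: 'a) \<noteq> 2"
  proof
    assume "(4 :: 'a) = 2"
    moreover have "(4 :: 'a) = 2 + 2" by simp
    ultimately show False using two by (metis add_cancel_left_left)
  qed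
  have dim: "dim_row (M_mat :: 'a mat) = 2" "dim_col (M_mat :: 'a mat) = 2"
    using M_mat_carrier by auto
  show "pairwise_independent_cols (1\<^sub>m 2 @\<^sub>c M_mat :: 'a mat)"
  proof (rule pairwise_independent_cols_two_rows)
    fix i j :: nat assume "i < j" "j < dim_col (1\<^sub>m 2 @\<^sub>c M_mat :: 'a mat)"
    then have "(i, j) \<in> {(0, 1), (0, 2), (0, 3), (1, 2), (1, 3), (2, 3)}"
      by (intro pairs_below_four) (auto simp: dim)
    then show "(1\<^sub>m 2 @\<^sub>c M_mat :: 'a mat) $$ (0, i) * (1\<^sub>m 2 @\<^sub>c M_mat) $$ (1, j)
        \<noteq> (1\<^sub>m 2 @\<^sub>c M_mat) $$ (0, j) * (1\<^sub>m 2 @\<^sub>c M_mat) $$ (1, i)"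
      using two neq by (auto simp: dim M_mat_index)
  qed (simp add: dim)
  show "pairwise_independent_cols (1\<^sub>m 2 @\<^sub>c (M_mat + 1\<^sub>m 2) :: 'a mat)"
  proof (rule pairwise_independent_cols_two_rows)
    fix i j :: nat assume "i < j" "j < dim_col (1\<^sub>m 2 @\<^sub>c (M_mat + 1\<^sub>m 2) :: 'a mat)"
    then have "(i, j) \<in> {(0, 1), (0, 2), (0, 3), (1, 2), (1, 3), (2, 3)}"
      by (intro pairs_below_four) (auto simp: dim)
    then show "(1\<^sub>m 2 @\<^sub>c (M_mat + 1\<^sub>m 2) :: 'a mat) $$ (0, i) * (1\<^sub>m 2 @\<^sub>c (M_mat + 1\<^sub>m 2)) $$ (1, j)
        \<noteq> (1\<^sub>m 2 @\<^sub>c (M_mat + 1\<^sub>m 2)) $$ (0, j) * (1\<^sub>m 2 @\<^sub>c (M_mat + 1\<^sub>m 2)) $$ (1, i)"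
      using two neq four by (auto simp: dim M_mat_index)
  qed (simp add: dim)
qed

section \<open>Arrays with at least three top rows\<close>

text \<open>
  Both halves of the construction for \<open>p \<ge> 3\<close> have this form, with identities and reversals for \<open>\<pi>\<close>
  and \<open>\<rho>\<close> and with \<open>t = 1\<close> or \<open>t = 2\<close>. Two columns deviate from
  constant vectors (0 or 1) in at most two rows, and with at least three rows a
  further row compares the constants; the exceptional rows then settle the rest.
  Note that \<open>1 + t\<close> may vanish, as it does for \<open>s = 3\<close> and \<open>t = 2\<close>.
\<close>

lemma unit_and_shifted_ones_independent:
  fixes E F :: "'a::field mat"
  assumes p: "3 \<le> p" and car: "E \<in> carrier_mat p p" "F \<in> carrier_mat p p" and t: "t \<noteq> 0"
    and \<pi>: "inj_on \<pi> {..<p}" "\<And>j. j < p \<Longrightarrow> \<pi> j < p"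
    and \<rho>: "inj_on \<rho> {..<p}" "\<And>j. j < p \<Longrightarrow> \<rho> j < p"
    and E: "\<And>r j. r < p \<Longrightarrow> j < p \<Longrightarrow> E $$ (r, j) = (if r = \<pi> j then 1 else 0)"
    and F: "\<And>r j. r < p \<Longrightarrow> j < p \<Longrightarrow> F $$ (r, j) = 1 + (if r = \<rho> j then t else 0)"
  shows "pairwise_independent_cols (E @\<^sub>c F)"
proof (rule pairwise_independent_colsI)
  fix i j a b assume "i < j" "j < dim_col (E @\<^sub>c F)"
    and zero': "\<And>r. r < dim_row (E @\<^sub>c F) \<Longrightarrow> a * (E @\<^sub>c F) $$ (r, i) + b * (E @\<^sub>c F) $$ (r, j) = 0"
  then have ij: "i < j" "j < p + p" using car by auto
  let ?entry = "\<lambda>r k. if k < p then E $$ (r, k) else F $$ (r, k - p)"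
  have zero: "a * ?entry r i + b * ?entry r j = 0" if "r < p" for r
  proof -
    have "(E @\<^sub>c F) $$ (r, k) = ?entry r k" if "k < p + p" for k
      using that \<open>r < p\<close> car by (cases "k < p") auto
    then show ?thesis using zero'[of r] that ij car by simp
  qed
  have third: "\<exists>r<p. r \<noteq> x \<and> r \<noteq> y" for x y
  proof -
    have "\<exists>r<3. r \<noteq> x \<and> r \<noteq> y" by presburger
    then show ?thesis using p by (meson less_le_trans)
  qed
  consider "j < p" | "i < p" "p \<le> j" | "p \<le> i" by linarith
  then show "a = 0 \<and> b = 0"
  proof cases
    case 1
    then have "\<pi> i \<noteq> \<pi> j" using \<pi>(1) ij by (auto simp: inj_on_def)
    then show ?thesis using zero[of "\<pi> i"] zero[of "\<pi> j"] 1 ij \<pi>(2) by (auto simp: E)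
  next
    case 2
    then have j: "j - p < p" using ij by auto
    obtain r where "r < p" "r \<noteq> \<pi> i" "r \<noteq> \<rho> (j - p)" using third by blast
    then have "b = 0" using zero[of r] 2 j by (simp add: E F)
    then show ?thesis using zero[of "\<pi> i"] 2 \<pi>(2) by (simp add: E)
  next
    case 3
    then have k: "i - p < p" "j - p < p" "i - p \<noteq> j - p" using ij by auto
    then have ne: "\<rho> (i - p) \<noteq> \<rho> (j - p)" using \<rho>(1) unfolding inj_on_def by blast
    obtain r where "r < p" "r \<noteq> \<rho> (i - p)" "r \<noteq> \<rho> (j - p)" using third by blast
    then have ab: "a + b = 0" using zero[of r] 3 k ij by (simp add: F)
    have "a * (1 + t) + b = 0" using zero[of "\<rho> (i - p)"] 3 k ij ne \<rho>(2) by (simp add: F)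
    moreover have "a * t = (a * (1 + t) + b) - (a + b)" by (simp add: algebra_simps)
    ultimately have "a * t = 0" using ab by simp
    then have "a = 0" using t by simp
    then show ?thesis using ab by simp
  qed
qed

lemma antidiag_mult:
  fixes B :: "'a::field mat"
  assumes "B \<in> carrier_mat p k" "i < p" "j < k"
  shows "(antidiag_mat p * B) $$ (i, j) = B $$ (p - 1 - i, j)"
proof -
  have "(antidiag_mat p * B) $$ (i, j) = (\<Sum>l\<in>{0..<p}. antidiag_mat p $$ (i, l) * B $$ (l, j))"
    using assms by (auto simp: antidiag_mat_def scalar_prod_def intro!: sum.cong)
  also have "\<dots> = (\<Sum>l\<in>{0..<p}. if p - 1 - i = l then B $$ (l, j) else 0)"
    using assms(2) by (intro sum.cong refl) (auto simp: antidiag_mat_def)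
  finally have "(antidiag_mat p * B) $$ (i, j) = (\<Sum>l\<in>{0..<p}. if p - 1 - i = l then B $$ (l, j) else 0)" .
  then show ?thesis using assms by simp
qed

lemma generator_c_blocks_independent:
  assumes p: "3 \<le> p" and two: "(2 :: 'a::field) \<noteq> 0"
  shows "pairwise_independent_cols (1\<^sub>m p @\<^sub>c (ones_mat p p + antidiag_mat p) :: 'a mat)"
    and "pairwise_independent_cols (antidiag_mat p @\<^sub>c (ones_mat p p + 2 \<cdot>\<^sub>m 1\<^sub>m p) :: 'a mat)"
  by (rule unit_and_shifted_ones_independent[OF p, where t=1 and \<pi>="\<lambda>j. j" and \<rho>="\<lambda>j. p - 1 - j"];
      auto simp: ones_mat_def antidiag_mat_def inj_on_def)
    (rule unit_and_shifted_ones_independent[OF p, where t=2 and \<rho>="\<lambda>j. j" and \<pi>="\<lambda>j. p - 1 - j"];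
      use two in \<open>auto simp: ones_mat_def antidiag_mat_def inj_on_def\<close>)

text \<open>
  Reversing the rows of \<open>J + H\<close> gives \<open>J + I\<close>, so the Schur complement is the identity.
\<close>

lemma generator_c_schur:
  "ones_mat p p + 2 \<cdot>\<^sub>m 1\<^sub>m p
    = antidiag_mat p * (ones_mat p p + antidiag_mat p) + (1\<^sub>m p :: 'a::field mat)"
proof (rule eq_matI)
  fix i j assume "i < dim_row (antidiag_mat p * (ones_mat p p + antidiag_mat p) + (1\<^sub>m p :: 'a mat))"
    and "j < dim_col (antidiag_mat p * (ones_mat p p + antidiag_mat p) + (1\<^sub>m p :: 'a mat))"
  then have ij: "i < p" "j < p" by simp_all
  have B: "ones_mat p p + antidiag_mat p \<in> carrier_mat p p"
    by (simp add: ones_mat_def antidiag_mat_def)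
  have "(antidiag_mat p * (ones_mat p p + antidiag_mat p)) $$ (i, j) = 1 + (if i = j then 1 else (0::'a))"
    unfolding antidiag_mult[OF B ij] using ij by (auto simp: ones_mat_def antidiag_mat_def)
  then show "(ones_mat p p + 2 \<cdot>\<^sub>m 1\<^sub>m p) $$ (i, j)
      = (antidiag_mat p * (ones_mat p p + antidiag_mat p) + (1\<^sub>m p :: 'a mat)) $$ (i, j)"
    using ij B by (auto simp: ones_mat_def antidiag_mat_def)
qed (auto simp: ones_mat_def antidiag_mat_def)

section \<open>Optimality of the three families\<close>

lemma two_nonzero_mod_ring:
  assumes "odd CARD('s::prime_card)"
  shows "(2 :: 's mod_ring) \<noteq> 0"
proof
  assume "(2 :: 's mod_ring) = 0"
  then have "CARD('s) dvd 2" using of_nat_0_mod_ring_dvd[of 2, where 'a='s] by simp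
  moreover have "prime CARD('s)" by (rule prime_card)
  ultimately have "CARD('s) = 2" using primes_dvd_imp_eq two_is_prime_nat by blast
  with assms show False by simp
qed

theorem theorem4:
  fixes s p q n :: nat
  assumes "CARD('s::prime_card) = s" and "odd s"
    and "1 \<le> p" and "p \<le> q" and "n = p + q"
  shows
    "(p = 1 \<longrightarrow>
        yields_2fi_optimal_full_factorial p q n (generator_a q :: 's mod_ring mat)) \<and>
     (p = 2 \<longrightarrow>
        (\<exists>X :: 's mod_ring mat. admissible_X q X) \<and>
        (\<forall>X :: 's mod_ring mat. admissible_X q X \<longrightarrow>
           yields_2fi_optimal_full_factorial p q n (generator_b q X))) \<and>
     (3 \<le> p \<longrightarrow>
        (\<exists>Y :: 's mod_ring mat. admissible_Y p q Y) \<and>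
        (\<forall>Y :: 's mod_ring mat. admissible_Y p q Y \<longrightarrow>
           yields_2fi_optimal_full_factorial p q n (generator_c p q Y)))"
proof -
  have two: "(2 :: 's mod_ring) \<noteq> 0" using assms(1,2) two_nonzero_mod_ring by blast
  have part_a: "yields_2fi_optimal_full_factorial p q n (generator_a q :: 's mod_ring mat)" if "p = 1"
    using generator_a_optimal[OF _ two, of q] assms that by simp
  have part_b: "(\<exists>X :: 's mod_ring mat. admissible_X q X) \<and>
      (\<forall>X :: 's mod_ring mat. admissible_X q X \<longrightarrow>
         yields_2fi_optimal_full_factorial p q n (generator_b q X))" if p: "p = 2"
  proof (intro conjI allI impI)
    have p2: "1 \<le> (2::nat)" "2 \<le> q" using p assms by simp_all
    note ind = generator_b_blocks_independent[OF two]
    \<comment> \<open>both expressions for \<open>\<alpha>\<close> divide by the number \<open>s + 1\<close> of points of \<open>PG(1, s)\<close>\<close>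
    have "CARD('s) ^ 2 - 1 = (CARD('s) + 1) * (CARD('s) - 1)"
      by (simp add: power2_eq_square algebra_simps)
    moreover have "CARD('s) - 1 > 0" using prime_gt_1_nat[OF prime_card[where 'a='s]] by simp
    ultimately have \<alpha>: "(2 + q) * (CARD('s) - 1) div (CARD('s) ^ 2 - 1) = (2 + q) div (CARD('s) + 1)"
      by (simp only: div_mult_mult2)
    show "\<exists>X :: 's mod_ring mat. admissible_X q X"
      using ex_balanced_third_block[OF p2 M_mat_carrier ind(1)]
      unfolding CARD_mod_ring \<alpha> admissible_X_def Let_def by blast
    fix X :: "'s mod_ring mat" assume X: "admissible_X q X"
    have "generator_b q X = block_generator 2 q M_mat (1\<^sub>m 2) (M_mat + 1\<^sub>m 2) X"
      unfolding generator_b_def block_generator_def ..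
    moreover have "yields_2fi_optimal_full_factorial 2 q (2 + q)
        (block_generator 2 q M_mat (1\<^sub>m 2) (M_mat + 1\<^sub>m 2) X)"
      using X M_mat_carrier unfolding admissible_X_def Let_def
      by (intro block_generator_optimal[OF p2 _ _ _ _ _ ind]) auto
    ultimately show "yields_2fi_optimal_full_factorial p q n (generator_b q X)"
      using p assms(5) by simp
  qed
  have part_c: "(\<exists>Y :: 's mod_ring mat. admissible_Y p q Y) \<and>
      (\<forall>Y :: 's mod_ring mat. admissible_Y p q Y \<longrightarrow>
         yields_2fi_optimal_full_factorial p q n (generator_c p q Y))" if p: "3 \<le> p"
  proof (intro conjI allI impI)
    note ind = generator_c_blocks_independent[OF p two]
    have car: "ones_mat p p + antidiag_mat p \<in> carrier_mat p p" "antidiag_mat p \<in> carrier_mat p p"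
      "ones_mat p p + 2 \<cdot>\<^sub>m 1\<^sub>m p \<in> carrier_mat p p"
      by (simp_all add: ones_mat_def antidiag_mat_def)
    show "\<exists>Y :: 's mod_ring mat. admissible_Y p q Y"
      using ex_balanced_third_block[OF assms(3,4) car(1) ind(1)]
      unfolding CARD_mod_ring admissible_Y_def Let_def by blast
    fix Y :: "'s mod_ring mat" assume Y: "admissible_Y p q Y"
    have "generator_c p q Y = block_generator p q (ones_mat p p + antidiag_mat p) (antidiag_mat p)
        (ones_mat p p + 2 \<cdot>\<^sub>m 1\<^sub>m p) Y"
      unfolding generator_c_def block_generator_def ..
    moreover have "yields_2fi_optimal_full_factorial p q (p + q)
        (block_generator p q (ones_mat p p + antidiag_mat p) (antidiag_mat p) (ones_mat p p + 2 \<cdot>\<^sub>m 1\<^sub>m p) Y)"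
      using Y unfolding admissible_Y_def Let_def
      by (intro block_generator_optimal[OF assms(3,4) car _ generator_c_schur ind]) auto
    ultimately show "yields_2fi_optimal_full_factorial p q n (generator_c p q Y)"
      using assms(5) by simp
  qed
  show ?thesis using part_a part_b part_c by blast
qed

end
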